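(* For $q\in\mathbb C$ with $\Re(q)>0$, $q\neq1$, and $y>0$, $$\begin{aligned}E(iy,q)=\;&2\left(\frac{y}{1+y^2}\right)^q\left[\zeta(2q-1)\,{}_2F_1\!\left(1,q;\tfrac32;\tfrac{1}{1+y^2}\right)+\zeta(2q-1)\,{}_2F_1\!\left(1,q;\tfrac32;\tfrac{y^2}{1+y^2}\right)\right]\\&+4\left(\frac{y}{1+y^2}\right)^q\sum_{s=1}^\infty 2^s\,\frac{\Gamma(s+q)}{s!\,\Gamma(q)}\left(\sum_{k=1}^s\binom{s}{k-1}\frac{(-1)^k}{2^k(s+k)}B_{s+k}\,\zeta(2q-1+s+k)\right)\frac{1+y^{2s}}{(1+y^2)^s},\end{aligned}$$ where the series over $s$ converges uniformly in $y$ on any compact interval in $(0,+\infty)$.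
   Context: On the imaginary axis the non-holomorphic Eisenstein series for $\mathrm{PSL}(2,\mathbb Z)$ is, for $\Re(q)>1$ and $y>0$, $$E(iy,q)=\zeta(2q)(y^q+y^{-q})+2\sum_{c,d\ge1}\left(\frac{y}{c^2y^2+d^2}\right)^q,$$ and it is extended meromorphically in $q$ to $\mathbb C$, with only a simple pole at $q=1$. $\zeta$ is the Riemann zeta function, $B_i$ are the Bernoulli numbers ($\sum_{i\ge0}B_it^i/i!=t/(e^t-1)$), and ${}_2F_1$ is the Gauss hypergeometric function. *)

theory Defs
  imports "HOL-Complex_Analysis.Complex_Analysis"
begin

text \<open>
  Value at \<open>s\<close> of the analytic continuation of \<open>f\<close>, given on the half-plane \<open>Re s > 1\<close>, to
  functions whose only singularity is at \<open>1\<close>. The continuation is taken along half-planes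
  \<open>Re z > \<sigma>\<close> punctured at \<open>1\<close>. These are connected and nested, so at most one value \<open>w\<close> qualifies
  for \<open>s \<noteq> 1\<close>, and it is the value of the continuation to the whole punctured plane if there is
  one (lemma \<open>continuation_off_1_eqI_plane\<close>). The value at \<open>s = 1\<close> is meaningless.
\<close>

definition continuation_off_1 :: "(complex \<Rightarrow> complex) \<Rightarrow> complex \<Rightarrow> complex" where
  "continuation_off_1 f s =
     (THE w. \<exists>\<sigma> g. \<sigma> < Re s \<and> g holomorphic_on ({z. \<sigma> < Re z} - {1}) \<and>
        (\<forall>z. 1 < Re z \<longrightarrow> g z = f z) \<and> g s = w)"

lemma continuation_off_1_eqI:
  assumes s: "\<sigma> < Re s" "s \<noteq> 1"
    and g: "g holomorphic_on ({z. \<sigma> < Re z} - {1})"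
    and gf: "\<And>z. 1 < Re z \<Longrightarrow> g z = f z"
  shows "continuation_off_1 f s = g s"
  unfolding continuation_off_1_def
proof (rule the_equality)
  show "\<exists>\<sigma>' g'. \<sigma>' < Re s \<and> g' holomorphic_on ({z. \<sigma>' < Re z} - {1}) \<and>
          (\<forall>z. 1 < Re z \<longrightarrow> g' z = f z) \<and> g' s = g s"
    using assms by blast
next
  fix w
  assume "\<exists>\<sigma>' g'. \<sigma>' < Re s \<and> g' holomorphic_on ({z. \<sigma>' < Re z} - {1}) \<and>
            (\<forall>z. 1 < Re z \<longrightarrow> g' z = f z) \<and> g' s = w"
  then obtain \<sigma>' g' where s': "\<sigma>' < Re s"
    and g': "g' holomorphic_on ({z. \<sigma>' < Re z} - {1})"
    and gf': "\<And>z. 1 < Re z \<Longrightarrow> g' z = f z" and w: "g' s = w"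
    by blast
  define \<tau> where "\<tau> = max \<sigma> \<sigma>'"
  have op: "open {z::complex. r < Re z}" for r
    by (rule open_halfspace_Re_gt)
  have "connected ({z::complex. \<tau> < Re z} - {1})"
    by (intro connected_open_delete op convex_connected convex_halfspace_Re_gt) simp
  moreover have "complex_of_real (max \<tau> 1 + 1) \<in> {z. max \<tau> 1 < Re z}"
    by (auto simp: max_def)
  then have "{z::complex. max \<tau> 1 < Re z} \<noteq> {}"
    by blast
  moreover have "{z::complex. max \<tau> 1 < Re z} \<subseteq> {z. \<tau> < Re z} - {1}"
    by auto
  moreover have "g' holomorphic_on ({z. \<tau> < Re z} - {1})" "g holomorphic_on ({z. \<tau> < Re z} - {1})"
    by (rule holomorphic_on_subset[OF g'] holomorphic_on_subset[OF g]; auto simp: \<tau>_def)+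
  moreover have "s \<in> {z. \<tau> < Re z} - {1}"
    using s s' by (simp add: \<tau>_def)
  ultimately have "g' s = g s"
    by (intro analytic_continuation_open[of "{z. max \<tau> 1 < Re z}" "{z. \<tau> < Re z} - {1}" g' g s] op open_delete)
       (simp_all add: gf gf')
  with w show "w = g s"
    by simp
qed

lemma continuation_off_1_eqI_plane:
  assumes "g holomorphic_on - {1}" "\<And>z. 1 < Re z \<Longrightarrow> g z = f z" "s \<noteq> 1"
  shows "continuation_off_1 f s = g s"
  using assms by (intro continuation_off_1_eqI[of "Re s - 1"]) (auto elim: holomorphic_on_subset)

definition riemann_zeta :: "complex \<Rightarrow> complex" where
  "riemann_zeta = continuation_off_1 (\<lambda>s. \<Sum>n. 1 / of_nat (Suc n) powr s)"

text \<open>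
  \<open>eisenstein_imag y q\<close> is \<open>E(iy, q)\<close>, the non-holomorphic Eisenstein series of
  \<open>PSL(2, \<int>)\<close> at the point \<open>iy\<close> of the imaginary axis.
\<close>

definition eisenstein_imag :: "real \<Rightarrow> complex \<Rightarrow> complex" where
  "eisenstein_imag y = continuation_off_1 (\<lambda>q.
     riemann_zeta (2 * q) * (of_real y powr q + of_real y powr (- q)) +
     2 * (\<Sum>\<^sub>\<infinity>(c, d) \<in> {1::nat..} \<times> {1::nat..}.
            of_real (y / ((real c)\<^sup>2 * y\<^sup>2 + (real d)\<^sup>2)) powr q))"

definition bernoulli_number :: "nat \<Rightarrow> real" where
  "bernoulli_number i = fact i * fps_nth (fps_X / (fps_exp 1 - 1)) i"

lemma bernoulli_number_egf:
  "Abs_fps (\<lambda>i. bernoulli_number i / fact i) * (fps_exp 1 - 1) = fps_X"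
proof -
  have "Abs_fps (\<lambda>i. bernoulli_number i / fact i) = fps_X / (fps_exp 1 - 1 :: real fps)"
    by (rule fps_ext) (simp add: bernoulli_number_def)
  moreover have "subdegree (fps_exp 1 - 1 :: real fps) = 1"
    by (rule subdegreeI) auto
  then have "(fps_exp 1 - 1 :: real fps) dvd fps_X"
    by (subst fps_dvd_iff) (auto simp: fps_X_neq_zero)
  ultimately show ?thesis
    by simp
qed

definition gauss_2F1 :: "complex \<Rightarrow> complex \<Rightarrow> complex \<Rightarrow> complex \<Rightarrow> complex" where
  "gauss_2F1 a b c z = eval_fps (fps_hypergeo [a, b] [c] 1) z"

definition eisenstein_series_term :: "complex \<Rightarrow> real \<Rightarrow> nat \<Rightarrow> complex" where
  "eisenstein_series_term q y s =
     2 ^ s * Gamma (of_nat s + q) / (fact s * Gamma q) *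
     (\<Sum>k = 1..s. of_nat (s choose (k - 1)) * (- 1) ^ k / (2 ^ k * of_nat (s + k)) *
        of_real (bernoulli_number (s + k)) * riemann_zeta (2 * q - 1 + of_nat s + of_nat k)) *
     of_real ((1 + y ^ (2 * s)) / (1 + y\<^sup>2) ^ s)"

end

theory Submission
  imports Defs
begin

text \<open>
  Put \<open>u = 1 / (1 + y\<^sup>2)\<close> and \<open>v = 1 - u\<close>. For \<open>Re q > 1\<close>, the lattice points with \<open>d \<le> c\<close> (those on the axis
  and on the diagonal with weight one half) contribute \<open>(y u) powr q\<close> times the sum over \<open>c\<close> of
  \<open>c powr (-2 q)\<close> times the trapezoidal sum, over the points \<open>x = d / c\<close>, of \<open>(1 - u (1 - x\<^sup>2)) powr (-q)\<close>;
  those with \<open>c \<le> d\<close> contribute the same with \<open>v\<close> for \<open>u\<close>. Expand by the binomial series and apply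
  Euler--Maclaurin summation to the polynomials \<open>(1 - x\<^sup>2) ^ s\<close>: the integrals
  \<open>s! / pochhammer (3/2) s\<close> add up to the hypergeometric function, and only the endpoint \<open>x = 1\<close>
  contributes to the correction terms, since the polynomial is even. The trapezoidal error is at most \<open>2 s\<^sup>2 / c\<close>,
  so the \<open>s\<close>-th coefficient of the series grows only polynomially in \<open>s\<close>. As \<open>u, v < 1\<close>, the series
  converges for \<open>Re q > 0\<close>, locally uniformly in \<open>q\<close> and \<open>y\<close>, and continues the identity.
\<close>

subsection \<open>Trapezoidal rule and series of holomorphic functions\<close>

lemma norm_diff_le_of_vector_derivative:
  fixes f :: "real \<Rightarrow> 'a::real_normed_vector"
  assumes "\<And>x. x \<in> {a..b} \<Longrightarrow> (f has_vector_derivative f' x) (at x)"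
    and "\<And>x. x \<in> {a..b} \<Longrightarrow> norm (f' x) \<le> B" and "a \<le> b"
  shows "norm (f b - f a) \<le> B * (b - a)"
proof -
  have "norm (f b - f a) \<le> B * norm (b - a)"
  proof (rule differentiable_bound[where S = "{a..b}" and f' = "\<lambda>x h. h *\<^sub>R f' x"])
    fix x assume x: "x \<in> {a..b}"
    show "(f has_derivative (\<lambda>h. h *\<^sub>R f' x)) (at x within {a..b})"
      using assms(1)[OF x] unfolding has_vector_derivative_def
      by (rule has_derivative_at_withinI)
    show "onorm (\<lambda>h. h *\<^sub>R f' x) \<le> B"
    proof (rule onorm_le)
      fix h :: real
      show "norm (h *\<^sub>R f' x) \<le> B * norm h"
        using mult_right_mono[OF assms(2)[OF x], of "\<bar>h\<bar>"] by (simp add: mult.commute)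
    qed
  qed (use assms(3) in auto)
  then show ?thesis using assms(3) by simp
qed

text \<open>As a function of the step length, the error \<open>\<phi>\<close> has derivative
  \<open>\<psi>\<close>, and \<open>\<psi>\<close> has derivative t/2 * f''(a + t). Both vanish at
  0, so two mean value estimates suffice; they give the constant 1/2 instead of the sharp 1/12.
  Vector values cover both complex powers and real polynomials.\<close>

lemma trapezoid_step_bound:
  fixes f :: "real \<Rightarrow> 'a::real_normed_vector"
  assumes h: "0 \<le> h"
    and F: "\<And>x. x \<in> {a..a+h} \<Longrightarrow> (F has_vector_derivative f x) (at x)"
    and f: "\<And>x. x \<in> {a..a+h} \<Longrightarrow> (f has_vector_derivative f' x) (at x)"
    and f': "\<And>x. x \<in> {a..a+h} \<Longrightarrow> (f' has_vector_derivative f'' x) (at x)"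
    and B: "\<And>x. x \<in> {a..a+h} \<Longrightarrow> norm (f'' x) \<le> B"
  shows "norm ((h / 2) *\<^sub>R (f a + f (a + h)) - (F (a + h) - F a)) \<le> B * h ^ 3 / 2"
proof -
  define \<phi> where "\<phi> t = (t / 2) *\<^sub>R (f a + f (a + t)) - (F (a + t) - F a)" for t
  define \<psi> where "\<psi> t = (1 / 2) *\<^sub>R (f a - f (a + t)) + (t / 2) *\<^sub>R f' (a + t)" for t
  have shift: "((\<lambda>t. g (a + t)) has_vector_derivative D) (at t)"
    if "(g has_vector_derivative D) (at (a + t))" for g :: "real \<Rightarrow> 'a" and D t
  proof -
    have "((\<lambda>t. a + t) has_vector_derivative 1) (at t)"
      using has_vector_derivative_add[OF has_vector_derivative_const has_vector_derivative_id] by simp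
    from vector_diff_chain_at[OF this that] show ?thesis by (simp add: o_def)
  qed
  have B0: "0 \<le> B"
    using order_trans[OF norm_ge_zero B[of a]] h by simp
  note scale_half = bounded_linear.has_vector_derivative[OF bounded_linear_scaleR_right[of "1 / 2"]]
  have half: "((\<lambda>t. t / 2) has_field_derivative 1 / 2) (at t)" for t :: real
    by (auto intro!: derivative_eq_intros)
  have d\<psi>: "(\<psi> has_vector_derivative (t / 2) *\<^sub>R f'' (a + t)) (at t)" if t: "t \<in> {0..h}" for t
  proof -
    have "(\<psi> has_vector_derivative (1 / 2) *\<^sub>R (0 - f' (a + t)) +
            ((t / 2) *\<^sub>R f'' (a + t) + (1 / 2) *\<^sub>R f' (a + t))) (at t)"
      unfolding \<psi>_def
      by (intro has_vector_derivative_add has_vector_derivative_scaleR scale_half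
          has_vector_derivative_diff has_vector_derivative_const half shift f f') (use t in auto)
    then show ?thesis by simp
  qed
  have d\<phi>: "(\<phi> has_vector_derivative \<psi> t) (at t)" if t: "t \<in> {0..h}" for t
  proof -
    have "(\<phi> has_vector_derivative ((t / 2) *\<^sub>R (0 + f' (a + t)) + (1 / 2) *\<^sub>R (f a + f (a + t)))
            - (f (a + t) - 0)) (at t)"
      unfolding \<phi>_def
      by (intro has_vector_derivative_add has_vector_derivative_scaleR
          has_vector_derivative_diff has_vector_derivative_const half shift f F) (use t in auto)
    moreover have "(1 / 2) *\<^sub>R (u + v) - v = (1 / 2) *\<^sub>R (u - v)" for u v :: 'a
    proof -
      have "(1 / 2) *\<^sub>R (u + v) - (1 / 2) *\<^sub>R (u - v) = (1 / 2) *\<^sub>R v + (1 / 2) *\<^sub>R v"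
        by (simp only: scaleR_add_right scaleR_diff_right) simp
      also have "\<dots> = v" by (simp flip: scaleR_add_left)
      finally show ?thesis by (metis add_diff_cancel_left' diff_add_cancel)
    qed
    from this[of "f a" "f (a + t)"]
    have "((t / 2) *\<^sub>R (0 + f' (a + t)) + (1 / 2) *\<^sub>R (f a + f (a + t))) - (f (a + t) - 0) = \<psi> t"
      unfolding \<psi>_def by (simp only: add_0 diff_0_right add_diff_eq[symmetric]) (simp only: add.commute)
    ultimately show ?thesis by simp
  qed
  have \<psi>_le: "norm (\<psi> t) \<le> B * h ^ 2 / 2" if t: "t \<in> {0..h}" for t
  proof -
    have "norm (\<psi> t - \<psi> 0) \<le> (h / 2 * B) * (t - 0)"
    proof (rule norm_diff_le_of_vector_derivative)
      fix x assume x: "x \<in> {0..t}"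
      then show "(\<psi> has_vector_derivative (x / 2) *\<^sub>R f'' (a + x)) (at x)"
        using t by (intro d\<psi>) auto
      show "norm ((x / 2) *\<^sub>R f'' (a + x)) \<le> h / 2 * B"
        using x t B[of "a + x"] B0 by (auto intro!: mult_mono)
    qed (use t in auto)
    also have "\<dots> \<le> (h / 2 * B) * h"
      using t B0 h by (intro mult_left_mono) auto
    finally show ?thesis by (simp add: \<psi>_def power2_eq_square algebra_simps)
  qed
  have "norm (\<phi> h - \<phi> 0) \<le> (B * h ^ 2 / 2) * (h - 0)"
    using d\<phi> \<psi>_le h by (intro norm_diff_le_of_vector_derivative[where f' = \<psi>]) auto
  then show ?thesis by (simp add: \<phi>_def power2_eq_square power3_eq_cube algebra_simps)
qed

text \<open>The M-test on small closed discs gives locally uniform convergence, and holomorphy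
  passes to such limits. Every continuation below is obtained this way.\<close>

lemma holomorphic_on_suminf_of_local_bound:
  fixes f :: "nat \<Rightarrow> complex \<Rightarrow> complex"
  assumes "open S" and "\<And>n. f n holomorphic_on S"
    and "\<And>z. z \<in> S \<Longrightarrow> \<exists>d>0. \<exists>M. cball z d \<subseteq> S \<and> summable M \<and>
           (\<forall>n. \<forall>w\<in>cball z d. norm (f n w) \<le> M n)"
  shows "(\<lambda>z. \<Sum>n. f n z) holomorphic_on S"
proof (rule holomorphic_uniform_sequence[where f = "\<lambda>N z. \<Sum>n<N. f n z"])
  fix z assume "z \<in> S"
  from assms(3)[OF this] obtain d M where "d > 0" "cball z d \<subseteq> S" "summable M"
    and "\<And>n w. w \<in> cball z d \<Longrightarrow> norm (f n w) \<le> M n"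
    by blast
  then show "\<exists>d>0. cball z d \<subseteq> S \<and>
               uniform_limit (cball z d) (\<lambda>N z. \<Sum>n<N. f n z) (\<lambda>z. \<Sum>n. f n z) sequentially"
    using Weierstrass_m_test[of "cball z d" f M] by blast
qed (use assms in \<open>auto intro!: holomorphic_intros\<close>)

text \<open>On such a disc, bounds in terms of \<open>Re w\<close> and \<open>norm w\<close> become
  one majorant for all \<open>w\<close>. The inequality \<open>\<sigma> < Re z - d\<close> does not
  involve \<open>w\<close>; the centre \<open>w = z\<close> yields it.\<close>

lemma cball_half_plane:
  assumes "\<sigma> < Re z" "open S" "z \<in> S"
  obtains d where "d > 0" "cball z d \<subseteq> S" "\<And>w. w \<in> cball z d \<Longrightarrow> \<sigma> < Re z - d \<and> Re z - d \<le> Re w"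
    "\<And>w. w \<in> cball z d \<Longrightarrow> norm w \<le> norm z + d"
proof -
  obtain e where e: "e > 0" "cball z e \<subseteq> S"
    using assms(2,3) open_contains_cball by blast
  define d where "d = min e ((Re z - \<sigma>) / 2)"
  have d: "d > 0" "d \<le> e" "\<sigma> < Re z - d"
    using e assms(1) by (auto simp: d_def min_def field_simps)
  show ?thesis
  proof (rule that)
    show "d > 0" by fact
    show "cball z d \<subseteq> S" using e d by (auto simp: subset_iff)
    fix w assume w: "w \<in> cball z d"
    have "\<bar>Re z - Re w\<bar> \<le> dist z w"
      by (metis abs_Re_le_cmod dist_norm minus_complex.sel(1))
    then show "\<sigma> < Re z - d \<and> Re z - d \<le> Re w" using w d by auto
    show "norm w \<le> norm z + d"
      using w norm_triangle_ineq3[of z w] by (simp add: dist_norm)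
  qed
qed

subsection \<open>The zeta function on \<open>Re w > -1\<close>\<close>

lemma summable_Suc_powr: "summable (\<lambda>n. real (Suc n) powr s)" if "s < -1"
  using that summable_real_powr_iff[of s] summable_Suc_iff[of "\<lambda>n. real n powr s"] by simp

lemma norm_nat_powr: "norm (of_nat (Suc n) powr w :: complex) = real (Suc n) powr Re w"
  by (subst norm_powr_real_powr) auto

lemma zeta_series_norm_summable:
  assumes "1 < Re w"
  shows "summable (\<lambda>n. norm (of_nat (Suc n) powr (-w) :: complex))"
  using assms summable_Suc_powr[of "- Re w"] unfolding norm_nat_powr by simp

text \<open>Trapezoidal rule for \<open>x powr (-w)\<close> on \<open>[n + 1, n + 2]\<close>: summed over \<open>n\<close>, the error terms
  continue the zeta function to \<open>Re w > -1\<close>.\<close>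

definition zeta_trapezoid_error :: "nat \<Rightarrow> complex \<Rightarrow> complex" where
  "zeta_trapezoid_error n w = (of_nat (Suc n) powr (-w) + of_nat (Suc (Suc n)) powr (-w)) / 2 -
     (of_nat (Suc (Suc n)) powr (1 - w) - of_nat (Suc n) powr (1 - w)) / (1 - w)"

text \<open>The second derivative w(w + 1) x^(-w - 2) is largest in norm at the left endpoint. The
  exponent -Re w - 2 is below -1 exactly for Re w > -1, which fixes the domain of the
  continuation.\<close>

lemma norm_zeta_trapezoid_error_le:
  assumes "-1 < Re w" "w \<noteq> 1"
  shows "norm (zeta_trapezoid_error n w) \<le> norm w * norm (w + 1) * real (Suc n) powr (- Re w - 2)"
proof -
  define a where "a = real (Suc n)"
  have a: "a \<ge> 1" by (simp add: a_def)
  define B where "B = norm w * norm (w + 1) * a powr (- Re w - 2)"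
  have D: "((\<lambda>x. of_real x powr v) has_vector_derivative v * of_real x powr (v - 1)) (at x)"
    if "x \<in> {a..a+1}" for x and v :: complex
    using that a has_vector_derivative_real_field[OF has_field_derivative_powr[of "of_real x" v]]
    by simp
  have "norm ((1 / 2) *\<^sub>R (of_real a powr (-w) + of_real (a + 1) powr (-w)) -
          (of_real (a + 1) powr (1 - w) / (1 - w) - of_real a powr (1 - w) / (1 - w)))
        \<le> B * 1 ^ 3 / 2"
  proof (rule trapezoid_step_bound)
    fix x assume x: "x \<in> {a..a+1}"
    have "((\<lambda>x. of_real x powr (1 - w) / (1 - w)) has_vector_derivative
             ((1 - w) * of_real x powr (1 - w - 1)) / (1 - w)) (at x)"
      by (intro has_vector_derivative_divide D x)
    then show "((\<lambda>x. of_real x powr (1 - w) / (1 - w)) has_vector_derivative of_real x powr (-w)) (at x)"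
      using assms by simp
    show "((\<lambda>x. of_real x powr (-w)) has_vector_derivative (-w) * of_real x powr (-w - 1)) (at x)"
      by (rule D[OF x])
    show "((\<lambda>x. (-w) * of_real x powr (-w - 1)) has_vector_derivative
            (-w) * ((-w - 1) * of_real x powr (-w - 1 - 1))) (at x)"
      by (intro has_vector_derivative_mult_right D x)
    have "norm ((-w) * ((-w - 1) * of_real x powr (-w - 1 - 1)))
        = norm w * norm (w + 1) * x powr (- Re w - 2)"
    proof -
      have "norm (- w - 1) = norm (w + 1)"
        using norm_minus_cancel[of "w + 1"] by simp
      moreover have "norm (of_real x powr (-w - 1 - 1)) = x powr (- Re w - 2)"
        using x a by (subst norm_powr_real_powr) (auto simp: algebra_simps)
      ultimately show ?thesis by (simp only: norm_mult norm_minus_cancel mult.assoc)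
    qed
    also have "\<dots> \<le> B"
      unfolding B_def using x a assms by (intro mult_left_mono powr_mono2') auto
    finally show "norm ((-w) * ((-w - 1) * of_real x powr (-w - 1 - 1))) \<le> B" .
  qed simp
  moreover have "of_real a = (of_nat (Suc n) :: complex)" "of_real (a + 1) = (of_nat (Suc (Suc n)) :: complex)"
    by (simp_all add: a_def)
  then have "zeta_trapezoid_error n w =
      (1 / 2) *\<^sub>R (of_real a powr (-w) + of_real (a + 1) powr (-w)) -
          (of_real (a + 1) powr (1 - w) / (1 - w) - of_real a powr (1 - w) / (1 - w))"
    by (simp only: zeta_trapezoid_error_def scaleR_conv_of_real diff_divide_distrib) simp
  ultimately have "norm (zeta_trapezoid_error n w) \<le> B / 2"
    by simp
  also have "\<dots> \<le> B" by (simp add: B_def)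
  finally show ?thesis by (simp add: B_def a_def)
qed

text \<open>For Re w > 1 the errors add up to zeta(w), less half its first term 1, less the integral
  1/(w - 1) of x^(-w) over [1, oo). The two explicit terms restore these.\<close>

definition zeta_cont :: "complex \<Rightarrow> complex" where
  "zeta_cont w = 1 / 2 + 1 / (w - 1) + (\<Sum>n. zeta_trapezoid_error n w)"

lemma zeta_cont_holomorphic: "zeta_cont holomorphic_on ({w. -1 < Re w} - {1})" (is "_ holomorphic_on ?S")
proof -
  have op: "open ?S" by (intro open_delete open_halfspace_Re_gt)
  have "(\<lambda>w. \<Sum>n. zeta_trapezoid_error n w) holomorphic_on ?S"
  proof (rule holomorphic_on_suminf_of_local_bound[OF op])
    show "zeta_trapezoid_error n holomorphic_on ?S" for n
      unfolding zeta_trapezoid_error_def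
      by (intro holomorphic_intros) auto
    fix z assume z: "z \<in> ?S"
    then obtain d where d: "d > 0" "cball z d \<subseteq> ?S"
      "\<And>w. w \<in> cball z d \<Longrightarrow> -1 < Re z - d \<and> Re z - d \<le> Re w"
      "\<And>w. w \<in> cball z d \<Longrightarrow> norm w \<le> norm z + d"
      using cball_half_plane[of "-1" z ?S] op by auto
    define M where "M n = (norm z + d) * (norm z + d + 1) * real (Suc n) powr (- (Re z - d) - 2)" for n
    have "summable M"
      unfolding M_def using d(1) d(3)[of z] by (intro summable_mult summable_Suc_powr) auto
    moreover have "norm (zeta_trapezoid_error n w) \<le> M n" if w: "w \<in> cball z d" for n w
    proof -
      have "norm (zeta_trapezoid_error n w) \<le> norm w * norm (w + 1) * real (Suc n) powr (- Re w - 2)"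
        using d(2) w by (intro norm_zeta_trapezoid_error_le) auto
      also have "\<dots> \<le> M n"
        unfolding M_def using d(3,4)[OF w] norm_triangle_ineq[of w 1] d(1)
        by (intro mult_mono powr_mono) auto
      finally show ?thesis .
    qed
    ultimately show "\<exists>d>0. \<exists>M. cball z d \<subseteq> ?S \<and> summable M \<and>
        (\<forall>n. \<forall>w\<in>cball z d. norm (zeta_trapezoid_error n w) \<le> M n)"
      using d by blast
  qed
  then show ?thesis
    unfolding zeta_cont_def by (intro holomorphic_intros) auto
qed

lemma zeta_cont_eq_series:
  assumes w: "1 < Re w"
  shows "zeta_cont w = (\<Sum>n. of_nat (Suc n) powr (-w))"
proof -
  let ?z = "\<Sum>n. of_nat (Suc n) powr (-w) :: complex"
  have w1: "w \<noteq> 1" using w by auto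
  \<comment> \<open>Interior nodes receive weight one half twice and the integrals telescope, so
    only boundary terms at 1 and \<open>Suc N\<close> remain; the latter tend to 0.\<close>
  have part: "(\<Sum>n<N. zeta_trapezoid_error n w) =
      (\<Sum>n<N. of_nat (Suc n) powr (-w)) - 1 / 2 + of_nat (Suc N) powr (-w) / 2
       - (of_nat (Suc N) powr (1 - w) - 1) / (1 - w)" for N
  proof (induction N)
    case (Suc N)
    have "(S - 1 / 2 + p / 2 - (r - 1) / d) + ((p + p') / 2 - (r' - r) / d)
        = S + p - 1 / 2 + p' / 2 - (r' - 1) / d" for S p p' r r' d :: complex
      by (simp add: add_divide_distrib diff_divide_distrib)
    then show ?case
      unfolding sum.lessThan_Suc Suc.IH unfolding zeta_trapezoid_error_def .
  qed simp
  have lim0: "(\<lambda>N. of_nat (Suc N) powr v :: complex) \<longlonglongrightarrow> 0" if "Re v < 0" for v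
  proof (rule tendsto_norm_zero_cancel)
    have "(\<lambda>N. real (Suc N) powr Re v) \<longlonglongrightarrow> 0"
      using that by (intro tendsto_neg_powr filterlim_compose[OF filterlim_real_sequentially filterlim_Suc])
    then show "(\<lambda>N. norm (of_nat (Suc N) powr v :: complex)) \<longlonglongrightarrow> 0"
      by (simp only: norm_nat_powr)
  qed
  have "(\<lambda>n. of_nat (Suc n) powr (-w) :: complex) sums ?z"
    by (rule summable_sums[OF summable_norm_cancel[OF zeta_series_norm_summable[OF w]]])
  then have z: "(\<lambda>N. \<Sum>n<N. of_nat (Suc n) powr (-w)) \<longlonglongrightarrow> ?z"
    by (simp only: sums_def)
  \<comment> \<open>The limit is left unevaluated so that \<open>part\<close> converges to it
    summand by summand.\<close>
  have "(\<lambda>n. zeta_trapezoid_error n w) sums (?z - 1 / 2 + 0 / 2 - (0 - 1) / (1 - w))"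
    unfolding sums_def part using w
    by (intro tendsto_diff tendsto_add tendsto_divide tendsto_const z lim0) (use w1 in auto)
  then have "(\<Sum>n. zeta_trapezoid_error n w) = ?z - 1 / 2 + 0 / 2 - (0 - 1) / (1 - w)"
    by (rule sums_unique[symmetric])
  moreover have "(0 - 1) / (1 - w) = 1 / (w - 1)"
    using minus_divide_divide[of 1 "w - 1"] by simp
  ultimately show ?thesis by (simp only: zeta_cont_def) (simp del: of_nat_Suc)
qed

text \<open>This domain suffices: the only zeta value needed outside the region of convergence is
  the one at 2q - 1, where Re q > 0 and q differs from 1.\<close>

lemma riemann_zeta_eq_cont: "-1 < Re w \<Longrightarrow> w \<noteq> 1 \<Longrightarrow> riemann_zeta w = zeta_cont w"
  unfolding riemann_zeta_def
  by (rule continuation_off_1_eqI[OF _ _ zeta_cont_holomorphic])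
     (simp_all add: zeta_cont_eq_series powr_minus_divide del: of_nat_Suc)

lemma riemann_zeta_holomorphic: "riemann_zeta holomorphic_on ({w. -1 < Re w} - {1})"
  using zeta_cont_holomorphic by (rule holomorphic_transform) (simp add: riemann_zeta_eq_cont)

lemma riemann_zeta_sums:
  assumes "1 < Re w"
  shows "(\<lambda>n. of_nat (Suc n) powr (-w)) sums riemann_zeta w"
proof -
  have "riemann_zeta w = (\<Sum>n. of_nat (Suc n) powr (-w))"
    using assms zeta_cont_eq_series[OF assms] riemann_zeta_eq_cont[of w] by (cases "w = 1") auto
  then show ?thesis
    using summable_sums[OF summable_norm_cancel[OF zeta_series_norm_summable[OF assms]]] by (simp only:)
qed

subsection \<open>Bernoulli numbers and Euler--Maclaurin summation\<close>

text \<open>Compare the coefficients of X^n in the generating function identity and multiply by n!.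
  The term k = n drops out because exp X - 1 has no constant term.\<close>

lemma bernoulli_number_recurrence:
  "(\<Sum>k<n. real (n choose k) * bernoulli_number k) = (if n = 1 then 1 else 0)"
proof -
  have "(\<Sum>k\<le>n. bernoulli_number k / fact k * fps_nth (fps_exp 1 - 1) (n - k)) = fps_nth fps_X n"
    by (subst bernoulli_number_egf[symmetric])
       (simp add: fps_mult_nth atMost_atLeast0)
  also have "(\<Sum>k\<le>n. bernoulli_number k / fact k * fps_nth (fps_exp 1 - 1) (n - k)) =
     (\<Sum>k<n. bernoulli_number k / fact k * (1 / fact (n - k)))"
    by (simp add: lessThan_Suc_atMost[symmetric] mult.commute)
  finally have "(\<Sum>k<n. bernoulli_number k / fact k * (1 / fact (n - k))) = (if n = 1 then 1 else 0)"
    by simp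
  then have "fact n * (\<Sum>k<n. bernoulli_number k / fact k * (1 / fact (n - k))) = (if n = 1 then 1 else 0)"
    by auto
  also have "fact n * (\<Sum>k<n. bernoulli_number k / fact k * (1 / fact (n - k)))
      = (\<Sum>k<n. real (n choose k) * bernoulli_number k)"
    unfolding sum_distrib_left by (intro sum.cong) (auto simp: binomial_fact mult.commute)
  finally show ?thesis .
qed

lemma bernoulli_number_0: "bernoulli_number 0 = 1"
  using bernoulli_number_recurrence[of 1] by simp

lemma bernoulli_number_1: "bernoulli_number 1 = - 1 / 2"
  using bernoulli_number_recurrence[of 2] bernoulli_number_0 by (simp add: numeral_2_eq_2)

text \<open>\<open>X / (exp X - 1) + X / 2\<close> is an even function.\<close>

lemma bernoulli_number_odd:
  assumes "odd n" "n \<noteq> 1"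
  shows "bernoulli_number n = 0"
proof -
  define G :: "real fps" where "G = Abs_fps (\<lambda>i. bernoulli_number i / fact i)"
  define G' where "G' = fps_compose G (- fps_X)"
  let ?E = "fps_exp 1 :: real fps" and ?E' = "fps_exp (-1) :: real fps"
  have egf: "G * (?E - 1) = fps_X"
    using bernoulli_number_egf by (simp add: G_def)
  have EE: "?E * ?E' = 1"
    by (simp add: fps_exp_add_mult[symmetric])
  have "fps_compose (G * (?E - 1)) (- fps_X) = - fps_X"
    unfolding egf by simp
  then have "G' * (?E' - 1) = - fps_X"
    using fps_exp_compose_linear[of 1 "-1::real"]
    by (simp add: G'_def fps_compose_mult_distrib fps_compose_sub_distrib
        fps_const_neg[symmetric] del: fps_const_neg)
  \<comment> \<open>Multiplying by exp X turns exp(-X) - 1 into 1 - exp X. As X exp X = X + X (exp X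
    - 1), cancelling exp X - 1 gives G(-X) = G(X) + X.\<close>
  then have "G' * (?E' - 1) * ?E = - fps_X * ?E" by simp
  then have "G' * (1 - ?E) = - fps_X * ?E"
    using EE by (simp add: algebra_simps)
  then have "G' * (?E - 1) = (G + fps_X) * (?E - 1)"
    using egf by (simp add: algebra_simps)
  moreover have "?E - 1 \<noteq> 0"
  proof
    assume "?E - 1 = 0"
    then have "fps_nth (?E - 1) 1 = 0" by simp
    then show False by simp
  qed
  ultimately have "G' = G + fps_X" by simp
  then have "fps_nth G' n = fps_nth G n" using assms by simp
  moreover have "fps_nth G' n = (-1) ^ n * fps_nth G n"
    using fps_nth_compose_linear[of G "-1" n]
    by (simp add: G'_def fps_const_neg[symmetric] del: fps_const_neg)
  ultimately show ?thesis using assms by (simp add: G_def)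
qed

text \<open>Umbral evaluation: \<open>X ^ j\<close> is sent to the Bernoulli number \<open>B\<^sub>j\<close>. The recurrence for the
  Bernoulli numbers says that shifting by one changes the value by the linear coefficient, which is
  Euler--Maclaurin summation for polynomials.\<close>

definition umbral :: "real poly \<Rightarrow> real" where
  "umbral p = (\<Sum>j\<le>degree p. coeff p j * bernoulli_number j)"

lemma umbral_eq_sum: "degree p \<le> n \<Longrightarrow> umbral p = (\<Sum>j\<le>n. coeff p j * bernoulli_number j)"
  unfolding umbral_def by (intro sum.mono_neutral_left) (auto simp: coeff_eq_0)

lemma umbral_add: "umbral (p + q) = umbral p + umbral q"
  using umbral_eq_sum[of p "max (degree p) (degree q)"] umbral_eq_sum[of q "max (degree p) (degree q)"]
    umbral_eq_sum[of "p + q" "max (degree p) (degree q)"] degree_add_le_max[of p q]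
  by (simp add: sum.distrib algebra_simps)

lemma umbral_smult: "umbral (smult c p) = c * umbral p"
  using umbral_eq_sum[OF degree_smult_le, of c p] by (simp add: umbral_def sum_distrib_left mult.assoc)

lemma umbral_0 [simp]: "umbral 0 = 0"
  by (simp add: umbral_def)

lemma umbral_sum: "umbral (sum f A) = (\<Sum>x\<in>A. umbral (f x))"
  by (induction A rule: infinite_finite_induct) (auto simp: umbral_add)

lemma umbral_monom: "umbral (monom c n) = c * bernoulli_number n"
proof -
  have "umbral (monom c n) = (\<Sum>j\<le>n. coeff (monom c n) j * bernoulli_number j)"
    by (rule umbral_eq_sum) (rule degree_monom_le)
  also have "\<dots> = (\<Sum>j\<le>n. if j = n then c * bernoulli_number n else 0)"
    by (intro sum.cong) auto
  finally show ?thesis by simp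
qed

lemma umbral_shift: "umbral (pcompose p [:1, 1:]) - umbral p = coeff p 1"
proof -
  \<comment> \<open>By linearity it suffices to treat (1 + X)^n: the binomial theorem produces the
    sum in the recurrence plus its missing top term.\<close>
  have X: "umbral ([:1, 1:] ^ n) = bernoulli_number n + (if n = 1 then 1 else 0)" for n
  proof -
    have "[:1, 1:] = monom (1::real) 1 + 1"
      by (simp add: monom_altdef one_pCons)
    then have "[:1, 1:] ^ n = (\<Sum>k\<le>n. of_nat (n choose k) * monom (1::real) 1 ^ k * 1 ^ (n - k))"
      by (simp only: binomial_ring)
    also have "\<dots> = (\<Sum>k\<le>n. monom (real (n choose k)) k)"
      by (intro sum.cong) (simp_all add: monom_power of_nat_poly smult_monom)
    finally have "umbral ([:1, 1:] ^ n) = (\<Sum>k\<le>n. real (n choose k) * bernoulli_number k)"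
      by (simp add: umbral_sum umbral_monom)
    also have "\<dots> = (\<Sum>k<n. real (n choose k) * bernoulli_number k) + bernoulli_number n"
      by (simp add: lessThan_Suc_atMost[symmetric])
    finally show ?thesis using bernoulli_number_recurrence[of n] by simp
  qed
  have "pcompose p [:1, 1:] = (\<Sum>j\<le>degree p. smult (coeff p j) ([:1, 1:] ^ j))"
    by (simp add: pcompose_altdef poly_altdef degree_map_poly coeff_map_poly)
  then have "umbral (pcompose p [:1, 1:]) =
      (\<Sum>j\<le>degree p. coeff p j * (bernoulli_number j + (if j = 1 then 1 else 0)))"
    by (simp add: umbral_sum umbral_smult X)
  also have "\<dots> = umbral p + (\<Sum>j\<le>degree p. if j = 1 then coeff p 1 else 0)"
    unfolding umbral_def sum.distrib[symmetric] by (intro sum.cong) (auto simp: algebra_simps)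
  also have "(\<Sum>j\<le>degree p. if j = 1 then coeff p 1 else 0) = coeff p 1"
    by (auto simp: coeff_eq_0)
  finally show ?thesis by simp
qed

text \<open>Telescoping of \<open>umbral_shift\<close>: the polynomial p(c h + h X) has linear
  coefficient h p'(c h), and replacing X by X + 1 moves to the next node.\<close>

lemma umbral_sum_shift:
  fixes p :: "real poly" and h :: real
  shows "umbral (pcompose p [:real c * h, h:]) - umbral (pcompose p [:0, h:])
    = (\<Sum>d<c. h * poly (pderiv p) (real d * h))"
proof (induction c)
  case (Suc c)
  define r where "r = pcompose p [:real c * h, h:]"
  have "pcompose r [:1, 1:] = pcompose p [:real (Suc c) * h, h:]"
    by (simp add: r_def pcompose_assoc[symmetric] pcompose_pCons algebra_simps)
  moreover have "coeff r 1 = h * poly (pderiv p) (real c * h)"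
  proof -
    have "coeff r 1 = poly (pderiv r) 0"
      by (simp add: coeff_pderiv poly_0_coeff_0)
    then show ?thesis
      by (simp add: r_def pderiv_pcompose poly_pcompose pderiv_pCons)
  qed
  ultimately show ?case
    using umbral_shift[of r] Suc by (simp add: r_def)
qed simp

section \<open>Antiderivatives of the even polynomials (1 - x^2)^s at the two endpoints\<close>

text \<open>The antiderivative of \<open>(1 - X\<^sup>2) ^ s\<close> that vanishes at 0, by integration by parts.\<close>

primrec bump_int :: "nat \<Rightarrow> real poly" where
  "bump_int 0 = [:0, 1:]"
| "bump_int (Suc s) = smult (1 / (2 * real s + 3))
     ([:0, 1:] * [:1, 0, -1:] ^ Suc s + smult (2 * real s + 2) (bump_int s))"

lemma poly_pderiv_bump_int: "poly (pderiv (bump_int s)) x = (1 - x\<^sup>2) ^ s"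
proof (induction s)
  case (Suc s)
  define q where "q = (1 - x\<^sup>2) ^ s"
  have "poly (pderiv (bump_int (Suc s))) x =
      1 / (2 * real s + 3) * ((1 - x\<^sup>2) * q + x * (real (Suc s) * q * (- 2 * x)) + (2 * real s + 2) * q)"
    using Suc unfolding bump_int.simps pderiv_smult pderiv_add pderiv_mult pderiv_power_Suc
    by (simp add: q_def pderiv_pCons power2_eq_square algebra_simps)
  also have "(1 - x\<^sup>2) * q + x * (real (Suc s) * q * (- 2 * x)) + (2 * real s + 2) * q
      = (2 * real s + 3) * ((1 - x\<^sup>2) * q)"
    by (simp add: power2_eq_square algebra_simps)
  finally show ?case by (simp add: q_def)
qed (simp add: pderiv_pCons)

lemma poly_bump_int_odd: "poly (bump_int s) (- x) = - poly (bump_int s) x"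
  by (induction s) (simp_all add: algebra_simps add_divide_distrib)

lemma poly_bump_int_0: "poly (bump_int s) 0 = 0"
  by (induction s) simp_all

text \<open>At 1 the boundary term of the integration by parts vanishes, leaving the factor (2s +
  2)/(2s + 3) = (1 + s)/(3/2 + s). This is where the parameters 1 and 3/2 of the hypergeometric
  function come from.\<close>

lemma poly_bump_int_1: "poly (bump_int s) 1 = pochhammer 1 s / pochhammer (3 / 2) s"
proof (induction s)
  case (Suc s)
  have "pochhammer (3 / 2 :: real) s \<noteq> 0"
    using pochhammer_pos[of "3 / 2 :: real" s] by simp
  then show ?case using Suc
    by (simp add: pochhammer_Suc divide_simps) (simp add: algebra_simps)
qed simp

lemma coeff_bump_int_even:
  assumes "even j"
  shows "coeff (bump_int s) j = 0"
proof -
  have "pcompose (bump_int s) [:0, -1:] = - bump_int s"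
    by (rule poly_ext) (simp add: poly_pcompose poly_bump_int_odd)
  then have "coeff (pcompose (bump_int s) [:0, -1:]) j = coeff (- bump_int s) j" by simp
  then show ?thesis using assms by (simp add: coeff_pcompose_linear)
qed

lemma coeff_bump_int_1: "coeff (bump_int s) 1 = 1"
  using poly_pderiv_bump_int[of s 0] by (simp add: poly_0_coeff_0 coeff_pderiv)

text \<open>Oddness of \<open>bump_int s\<close> kills the even coefficients, and the odd Bernoulli
  numbers beyond the first vanish, so only the linear term survives. The value -h/2 will match the
  half weight of the trapezoidal rule at 0.\<close>

lemma umbral_bump_int_at_0: "umbral (pcompose (bump_int s) [:0, h:]) = - h / 2"
proof -
  \<comment> \<open>The maximum keeps index 1 in range even if \<open>h = 0\<close>.\<close>
  define n where "n = max 1 (degree (pcompose (bump_int s) [:0, h:]))"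
  have "umbral (pcompose (bump_int s) [:0, h:]) =
      (\<Sum>j\<le>n. coeff (pcompose (bump_int s) [:0, h:]) j * bernoulli_number j)"
    by (rule umbral_eq_sum) (simp add: n_def)
  also have "\<dots> = (\<Sum>j\<in>{1}. coeff (pcompose (bump_int s) [:0, h:]) j * bernoulli_number j)"
  proof (rule sum.mono_neutral_right)
    show "\<forall>j\<in>{..n} - {1}. coeff (pcompose (bump_int s) [:0, h:]) j * bernoulli_number j = 0"
      using coeff_bump_int_even bernoulli_number_odd by (auto simp: coeff_pcompose_linear)
  qed (auto simp: n_def)
  also have "\<dots> = - h / 2"
    using bernoulli_number_1 coeff_bump_int_1 by (simp add: coeff_pcompose_linear)
  finally show ?thesis .
qed

lemma poly_eqI_pderiv:
  fixes p q :: "real poly"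
  assumes "pderiv p = pderiv q" "poly p 0 = poly q 0"
  shows "p = q"
proof -
  have "pderiv (p - q) = 0" using assms by (simp add: pderiv_diff)
  then have "degree (p - q) = 0" by (simp add: pderiv_eq_0_iff)
  then obtain c where c: "p - q = [:c:]" using degree_0_id by metis
  moreover have "poly (p - q) 0 = 0" using assms by simp
  ultimately show ?thesis by simp
qed

text \<open>The derivative is h (1 - (1 + hX)^2)^s = h (-hX)^s (hX + 2)^s; expand the last factor
  and integrate termwise. The zero of order s at the endpoint is why only Bernoulli numbers with
  index above s occur.\<close>

lemma bump_int_at_1:
  "pcompose (bump_int s) [:1, h:] = [:poly (bump_int s) 1:] +
     (\<Sum>i\<le>s. monom (h ^ (s + i + 1) * (-1) ^ s * real (s choose i) * 2 ^ (s - i) / real (s + i + 1))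
        (s + i + 1))" (is "?L = ?R")
proof (rule poly_eqI_pderiv)
  show "pderiv ?L = pderiv ?R"
  proof (rule poly_ext)
    fix x
    have "poly (pderiv ?L) x = h * (1 - (1 + h * x)\<^sup>2) ^ s"
      by (simp add: pderiv_pcompose poly_pcompose poly_pderiv_bump_int pderiv_pCons mult.commute)
    also have "(1 - (1 + h * x)\<^sup>2) = (-1) * (h * x) * (h * x + 2)"
      by (simp add: power2_eq_square algebra_simps)
    also have "h * ((-1) * (h * x) * (h * x + 2)) ^ s =
        h * (((-1) * (h * x)) ^ s * (\<Sum>i\<le>s. real (s choose i) * (h * x) ^ i * 2 ^ (s - i)))"
      unfolding power_mult_distrib[of "(-1) * (h * x)"] binomial_ring ..
    also have "\<dots> = (\<Sum>i\<le>s. h ^ (s + i + 1) * (-1) ^ s * real (s choose i) * 2 ^ (s - i) * x ^ (s + i))"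
      unfolding sum_distrib_left by (intro sum.cong refl) (simp add: power_minus[of "h * x" s] power_mult_distrib power_add)
    also have "\<dots> = poly (pderiv ?R) x"
      unfolding pderiv_add higher_pderiv_sum[of 1, simplified] poly_add poly_sum pderiv_monom poly_monom
      by (auto simp: pderiv_pCons simp del: of_nat_add of_nat_Suc intro!: sum.cong)
    finally show "poly (pderiv ?L) x = poly (pderiv ?R) x" .
  qed
  show "poly ?L 0 = poly ?R 0"
    by (simp add: poly_pcompose poly_sum poly_monom)
qed

section \<open>Trapezoidal sums of (1 - x^2)^s: exact error and bound\<close>

definition trapezoid :: "nat \<Rightarrow> (real \<Rightarrow> 'a) \<Rightarrow> 'a::real_normed_vector" where
  "trapezoid c f = (\<Sum>d<c. (1 / 2) *\<^sub>R (f (real d / real c) + f (real (Suc d) / real c)))"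

lemma trapezoid_eq_left_sum:
  assumes "c > 0"
  shows "trapezoid c f = (\<Sum>d<c. f (real d / real c)) - (1 / 2) *\<^sub>R f 0 + (1 / 2) *\<^sub>R f 1"
proof -
  have "trapezoid c f = (\<Sum>d<c. f (real d / real c)) +
      (1 / 2) *\<^sub>R (\<Sum>d<c. f (real (Suc d) / real c) - f (real d / real c))"
  proof -
    have "(1 / 2) *\<^sub>R (u + v) = u + (1 / 2) *\<^sub>R (v - u)" for u v :: 'a
    proof -
      have "(1 / 2) *\<^sub>R (u + v) - (1 / 2) *\<^sub>R (v - u) = (1 / 2) *\<^sub>R u + (1 / 2) *\<^sub>R u"
        by (simp only: scaleR_add_right scaleR_diff_right) simp
      also have "\<dots> = u" by (simp flip: scaleR_add_left)
      finally show ?thesis by (simp only: diff_eq_eq)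
    qed
    then show ?thesis unfolding trapezoid_def scaleR_sum_right sum.distrib[symmetric] by simp
  qed
  also have "(\<Sum>d<c. f (real (Suc d) / real c) - f (real d / real c)) = f 1 - f 0"
    using sum_lessThan_telescope[of "\<lambda>d. f (real d / real c)" c] assms by simp
  finally show ?thesis by (simp add: scaleR_diff_right)
qed

lemma trapezoid_eq_inner_sum:
  assumes "c > 0"
  shows "trapezoid c f = (1 / 2) *\<^sub>R f 0 + (1 / 2) *\<^sub>R f 1 + (\<Sum>d=1..<c. f (real d / real c))"
proof -
  have "{..<c} = insert 0 {1..<c}" using assms by auto
  then have "(\<Sum>d<c. f (real d / real c)) = f 0 + (\<Sum>d=1..<c. f (real d / real c))" by simp
  moreover have "f 0 - (1 / 2) *\<^sub>R f 0 = (1 / 2) *\<^sub>R f 0"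
    using scaleR_diff_left[of 1 "1 / 2" "f 0"] by simp
  ultimately show ?thesis
    unfolding trapezoid_eq_left_sum[OF assms] by (simp add: algebra_simps)
qed

text \<open>\<open>trapezoid c\<close> is not divided by \<open>c\<close>, so it approximates
  \<open>c\<close> times the integral over [0, 1].\<close>

definition trap_err :: "nat \<Rightarrow> nat \<Rightarrow> real" where
  "trap_err s c = trapezoid c (\<lambda>x. (1 - x\<^sup>2) ^ s) - real c * poly (bump_int s) 1"

lemma trap_err_0: "trap_err 0 c = 0"
  by (simp add: trap_err_def trapezoid_def)

text \<open>Euler-Maclaurin summation with step \<open>h = 1 / c\<close>: \<open>c\<close> shifts
  lead from endpoint 0 to endpoint 1. As s > 0, the integrand vanishes at 1, so the half weight at 0
  is the only one to account for.\<close>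

lemma trap_err_eq:
  assumes c: "c > 0" and s: "s > 0"
  shows "trap_err s c = 2 ^ Suc s * (\<Sum>k=1..s. real (s choose (k - 1)) * (-1) ^ k / (2 ^ k * real (s + k)) *
           bernoulli_number (s + k) * (1 / real c) ^ (s + k - 1))"
proof -
  define h where "h = 1 / real c"
  have h: "h > 0" "real c * h = 1" using c by (simp_all add: h_def)
  let ?t = "\<lambda>i. (-1) ^ s * real (s choose i) * 2 ^ (s - i) / real (s + i + 1) * bernoulli_number (s + i + 1)"
  have "trapezoid c (\<lambda>x. (1 - x\<^sup>2) ^ s) = (\<Sum>d<c. (1 - (real d * h)\<^sup>2) ^ s) - 1 / 2"
    using s by (subst trapezoid_eq_left_sum[OF c]) (simp add: h_def)
  then have "h * trapezoid c (\<lambda>x. (1 - x\<^sup>2) ^ s) = (\<Sum>d<c. h * (1 - (real d * h)\<^sup>2) ^ s) - h / 2"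
    by (simp only: right_diff_distrib sum_distrib_left)
  also have "\<dots> = umbral (pcompose (bump_int s) [:1, h:])"
    using umbral_sum_shift[of "bump_int s" c h] h(2)
    by (simp add: umbral_bump_int_at_0 poly_pderiv_bump_int)
  also have "[:poly (bump_int s) 1:] = monom (poly (bump_int s) 1) 0"
    by (simp add: monom_0)
  then have "umbral (pcompose (bump_int s) [:1, h:]) = poly (bump_int s) 1 + (\<Sum>i\<le>s. h ^ (s + i + 1) * ?t i)"
    unfolding bump_int_at_1
    by (simp add: umbral_add umbral_sum umbral_monom bernoulli_number_0 mult_ac)
  also have "(\<Sum>i\<le>s. h ^ (s + i + 1) * ?t i) = h * (\<Sum>i\<le>s. ?t i * h ^ (s + i))"
    unfolding sum_distrib_left by (intro sum.cong) (simp_all add: mult_ac)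
  finally have "trapezoid c (\<lambda>x. (1 - x\<^sup>2) ^ s) = poly (bump_int s) 1 * real c + (\<Sum>i\<le>s. ?t i * h ^ (s + i))"
    using h c by (simp add: h_def field_simps)
  then have "trap_err s c = (\<Sum>i\<le>s. ?t i * h ^ (s + i))"
    by (simp add: trap_err_def)
  \<comment> \<open>The term i = s carries the Bernoulli number of odd index 2s + 1 > 1, which is 0.
    Hence k = i + 1 ends at s.\<close>
  also have "\<dots> = (\<Sum>i<s. ?t i * h ^ (s + i))"
    using bernoulli_number_odd[of "s + s + 1"] s by (simp add: lessThan_Suc_atMost[symmetric])
  also have "\<dots> = (\<Sum>k=1..s. ?t (k - 1) * h ^ (s + (k - 1)))"
    by (rule sum.reindex_bij_witness[of _ "\<lambda>k. k - 1" Suc]) auto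
  also have "\<dots> = (\<Sum>k=1..s. 2 ^ Suc s * (real (s choose (k - 1)) * (-1) ^ k / (2 ^ k * real (s + k)) *
           bernoulli_number (s + k) * h ^ (s + k - 1)))"
  proof (rule sum.cong[OF refl])
    fix k assume k: "k \<in> {1..s}"
    then have pow: "(2::real) ^ (s - (k - 1)) = 2 ^ Suc s / 2 ^ k"
      by (subst power_diff[symmetric]) (auto simp: Suc_diff_le)
    show "?t (k - 1) * h ^ (s + (k - 1)) = 2 ^ Suc s * (real (s choose (k - 1)) * (-1) ^ k / (2 ^ k * real (s + k)) *
           bernoulli_number (s + k) * h ^ (s + k - 1))"
    \<comment> \<open>The expansion has the sign (-1)^s, the claim (-1)^k. They agree for even s +
      k; for odd s + k >= 2 the Bernoulli number vanishes.\<close>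
    proof (cases "even (s + k)")
      case True
      then have "(-1) ^ s = ((-1) ^ k :: real)" by (auto simp: uminus_power_if)
      then show ?thesis using k unfolding pow by simp
    next
      case False
      then show ?thesis using k bernoulli_number_odd[of "s + k"] by simp
    qed
  qed
  finally show ?thesis by (simp only: sum_distrib_left h_def)
qed

text \<open>Instead of estimating Bernoulli numbers, apply the trapezoidal estimate on each of the c
  intervals: |f''| <= 4 s^2 on [0, 1] gives 2 s^2 / c^3 per interval, and the normalisation
  contributes one more factor c. For c = 0 both sides are 0.\<close>

lemma trap_err_bound: "\<bar>trap_err s c\<bar> \<le> 2 * (real s)\<^sup>2 / real c"
proof (cases "c = 0")
  case True
  then show ?thesis by (simp add: trap_err_def trapezoid_def)
next
  case False
  define h where "h = 1 / real c"
  have h: "h > 0" "real c * h = 1" using False by (simp_all add: h_def)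
  let ?f = "\<lambda>x. (1 - x\<^sup>2) ^ s" and ?F = "poly (bump_int s)"
  let ?f' = "\<lambda>x. - 2 * real s * (x * (1 - x\<^sup>2) ^ (s - 1))"
  \<comment> \<open>The truncated exponents \<open>s - 1\<close> and \<open>s - 2\<close> are
    harmless, since the factors \<open>real s\<close> and \<open>real (s - 1)\<close> vanish
    whenever truncation occurs.\<close>
  let ?f'' = "\<lambda>x. - 2 * real s * ((1 - x\<^sup>2) ^ (s - 1) - 2 * x\<^sup>2 * (real (s - 1) * (1 - x\<^sup>2) ^ (s - 2)))"
  have step: "\<bar>(h / 2) * (?f (real d * h) + ?f (real d * h + h)) - (?F (real d * h + h) - ?F (real d * h))\<bar>
      \<le> 4 * (real s)\<^sup>2 * h ^ 3 / 2" if d: "d < c" for d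
  proof -
    have "norm ((h / 2) *\<^sub>R (?f (real d * h) + ?f (real d * h + h)) - (?F (real d * h + h) - ?F (real d * h)))
      \<le> 4 * (real s)\<^sup>2 * h ^ 3 / 2"
    proof (rule trapezoid_step_bound)
      fix x assume "x \<in> {real d * h..real d * h + h}"
      moreover have "real d * h + h \<le> real c * h"
        using mult_right_mono[of "real d + 1" "real c" h] d h(1) by (simp add: distrib_right)
      ultimately have x: "0 \<le> x" "x \<le> 1"
        using h by (auto intro: order_trans[of _ "real d * h"])
      show "(?F has_vector_derivative ?f x) (at x)"
        using poly_DERIV[of "bump_int s" x]
        by (simp add: poly_pderiv_bump_int has_real_derivative_iff_has_vector_derivative)
      show "(?f has_vector_derivative ?f' x) (at x)"
        unfolding has_real_derivative_iff_has_vector_derivative[symmetric]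
        by (auto intro!: derivative_eq_intros)
      show "(?f' has_vector_derivative ?f'' x) (at x)"
        unfolding has_real_derivative_iff_has_vector_derivative[symmetric]
        by (auto intro!: derivative_eq_intros simp: power2_eq_square numeral_2_eq_2)
      have u: "0 \<le> (1 - x\<^sup>2) ^ n" "(1 - x\<^sup>2) ^ n \<le> 1" "x\<^sup>2 \<le> 1" for n
        using x by (auto intro!: zero_le_power power_le_one simp: power_le_one abs_square_le_1)
      have v: "0 \<le> x\<^sup>2 * (1 - x\<^sup>2) ^ (s - 2)" "x\<^sup>2 * (1 - x\<^sup>2) ^ (s - 2) \<le> 1"
        using u by (auto intro: mult_le_one)
      have "\<bar>(1 - x\<^sup>2) ^ (s - 1) - 2 * x\<^sup>2 * (real (s - 1) * (1 - x\<^sup>2) ^ (s - 2))\<bar>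
          \<le> 1 + 2 * real (s - 1) * 1"
      proof -
        have "\<bar>(1 - x\<^sup>2) ^ (s - 1) - 2 * real (s - 1) * (x\<^sup>2 * (1 - x\<^sup>2) ^ (s - 2))\<bar>
          \<le> \<bar>(1 - x\<^sup>2) ^ (s - 1)\<bar> + \<bar>2 * real (s - 1) * (x\<^sup>2 * (1 - x\<^sup>2) ^ (s - 2))\<bar>"
          by (rule abs_triangle_ineq4)
        also have "\<dots> \<le> 1 + 2 * real (s - 1) * 1"
          using u v by (intro add_mono) (auto simp: abs_mult intro!: mult_left_le)
        finally show ?thesis by (simp add: mult_ac)
      qed
      then have "\<bar>?f'' x\<bar> \<le> 2 * real s * (1 + 2 * real (s - 1) * 1)"
        unfolding abs_mult by (intro mult_mono) auto
      also have "\<dots> \<le> 4 * (real s)\<^sup>2"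
        by (cases s) (auto simp: power2_eq_square algebra_simps)
      finally show "norm (?f'' x) \<le> 4 * (real s)\<^sup>2" by simp
    qed (use h in simp)
    then show ?thesis by simp
  qed
  have "(\<Sum>d<c. ?F (real d * h + h) - ?F (real d * h)) =
      (\<Sum>d<c. ?F (real (Suc d) * h) - ?F (real d * h))"
    by (intro sum.cong refl) (simp only: of_nat_Suc distrib_right mult_1 add.commute)
  also have "\<dots> = ?F (real c * h) - ?F (real 0 * h)"
    by (rule sum_lessThan_telescope)
  finally have tel: "(\<Sum>d<c. ?F (real d * h + h) - ?F (real d * h)) = ?F 1"
    by (simp only: h(2)) (simp add: poly_bump_int_0)
  have "real (Suc d) / real c = real d * h + h" "real d / real c = real d * h" for d
    by (simp_all add: h_def add_divide_distrib)
  then have trap: "h * trapezoid c ?f = (\<Sum>d<c. (h / 2) * (?f (real d * h) + ?f (real d * h + h)))"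
    unfolding trapezoid_def sum_distrib_left by (intro sum.cong refl) simp
  have "h * (real c * ?F 1) = ?F 1"
    using arg_cong[OF h(2), of "\<lambda>u. u * ?F 1"] by (simp only: mult_ac mult_1)
  then have "h * trap_err s c = (\<Sum>d<c. (h / 2) * (?f (real d * h) + ?f (real d * h + h))) - ?F 1"
    by (simp only: trap_err_def right_diff_distrib trap)
  then have "h * trap_err s c = (\<Sum>d<c. (h / 2) * (?f (real d * h) + ?f (real d * h + h)) - (?F (real d * h + h) - ?F (real d * h)))"
    unfolding sum_subtractf[of _ "\<lambda>d. ?F (real d * h + h) - ?F (real d * h)"] tel .
  then have "\<bar>h * trap_err s c\<bar> \<le> (\<Sum>d<c. 4 * (real s)\<^sup>2 * h ^ 3 / 2)"
    by (simp only:) (rule order_trans[OF sum_abs], intro sum_mono step, simp)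
  also have "\<dots> = (real c * h) * (h * (2 * (real s)\<^sup>2 * h))"
    by (simp add: power3_eq_cube)
  also have "\<dots> = h * (2 * (real s)\<^sup>2 * h)"
    by (simp only: h(2) mult_1)
  finally have "\<bar>trap_err s c\<bar> \<le> 2 * (real s)\<^sup>2 * h"
    using h(1) by (simp only: abs_mult abs_of_pos mult_le_cancel_left_pos)
  then show ?thesis by (simp add: h_def)
qed

subsection \<open>Analytic dependence on the parameter\<close>

lemma norm_pochhammer_le: "norm (q::complex) \<le> R \<Longrightarrow> norm (pochhammer q s) \<le> pochhammer R s"
proof (induction s)
  case (Suc s)
  have "norm (q + of_nat s) \<le> R + real s"
    using norm_triangle_ineq[of q "of_nat s"] Suc.prems by simp
  moreover have "0 \<le> pochhammer R s"
    using order_trans[OF norm_ge_zero Suc.IH[OF Suc.prems]] .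
  ultimately show ?case
    using Suc by (simp add: pochhammer_Suc norm_mult mult_mono)
qed simp

text \<open>Common majorant of all series over s: \<open>R\<close> bounds |q|, \<open>r\<close>
  bounds the base 1/(1 + y^2) or y^2/(1 + y^2), and the square absorbs the quadratic growth of the
  trapezoidal errors.\<close>

definition pochhammer_majorant :: "real \<Rightarrow> real \<Rightarrow> nat \<Rightarrow> real" where
  "pochhammer_majorant R r s = pochhammer R s / fact s * (real s + 1)\<^sup>2 * r ^ s"

lemma summable_pochhammer_majorant:
  assumes "0 < R" "0 \<le> r" "r < 1"
  shows "summable (pochhammer_majorant R r)"
proof -
  let ?t = "\<lambda>s. inverse (real (Suc s))"
  \<comment> \<open>The ratio of consecutive terms, written in 1/(s + 1) so that its limit
    \<open>r\<close> can be read off; the midpoint of \<open>r\<close> and 1 then serves in the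
    ratio test.\<close>
  define \<rho> where "\<rho> s = (1 + (R - 1) * ?t s) * (1 + ?t s)\<^sup>2 * r" for s
  have "\<rho> \<longlonglongrightarrow> (1 + (R - 1) * 0) * (1 + 0)\<^sup>2 * r"
    unfolding \<rho>_def by (intro tendsto_intros LIMSEQ_inverse_real_of_nat)
  then have "eventually (\<lambda>s. \<rho> s < (1 + r) / 2) sequentially"
    using assms by (intro order_tendstoD(2)) auto
  then obtain N where N: "\<And>s. s \<ge> N \<Longrightarrow> \<rho> s < (1 + r) / 2"
    by (auto simp: eventually_sequentially)
  have rec: "pochhammer_majorant R r (Suc s) = \<rho> s * pochhammer_majorant R r s" for s
  proof -
    define m where "m = real (Suc s)"
    have m: "real s + 1 = m" "real (Suc s) = m" "m \<noteq> 0" by (simp_all add: m_def)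
    have "1 + (R - 1) * ?t s = (R + real s) / m" "1 + ?t s = (m + 1) / m"
      unfolding m(2) using m(3) by (simp_all add: field_simps flip: m(1))
    then have \<rho>: "\<rho> s = (R + real s) / m * ((m + 1) / m)\<^sup>2 * r"
      by (simp only: \<rho>_def)
    have "pochhammer_majorant R r (Suc s) = pochhammer R s * (R + real s) / (m * fact s) * (m + 1)\<^sup>2 * (r * r ^ s)"
      by (simp only: pochhammer_majorant_def pochhammer_Suc fact_Suc m(2) power_Suc)
    moreover have "pochhammer_majorant R r s = pochhammer R s / fact s * m\<^sup>2 * r ^ s"
      by (simp only: pochhammer_majorant_def m(1))
    ultimately show ?thesis
      using m(3) by (simp add: \<rho> power_divide)
  qed
  have nn: "0 \<le> pochhammer_majorant R r s" for s
    using assms pochhammer_pos[of R s] by (simp add: pochhammer_majorant_def)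
  show ?thesis
  proof (rule summable_ratio_test)
    show "(1 + r) / 2 < 1" using assms by simp
    fix s assume "s \<ge> N"
    then have "\<rho> s * pochhammer_majorant R r s \<le> (1 + r) / 2 * pochhammer_majorant R r s"
      using N[of s] nn[of s] by (intro mult_right_mono) auto
    then show "norm (pochhammer_majorant R r (Suc s)) \<le> (1 + r) / 2 * norm (pochhammer_majorant R r s)"
      using nn[of s] nn[of "Suc s"] by (simp add: rec)
  qed
qed

lemma norm_pochhammer_term_le:
  assumes "norm q \<le> R" "norm z \<le> C * (real s + 1)\<^sup>2" "0 \<le> b" "b \<le> r"
  shows "norm (pochhammer q s / fact s * z * of_real b ^ s :: complex) \<le> C * pochhammer_majorant R r s"
proof -
  have P: "norm (pochhammer q s) \<le> pochhammer R s" using norm_pochhammer_le[OF assms(1)] .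
  then have P0: "0 \<le> pochhammer R s" using order_trans[OF norm_ge_zero] by blast
  have C0: "0 \<le> C * (real s + 1)\<^sup>2" using order_trans[OF norm_ge_zero assms(2)] .
  have "norm (pochhammer q s / fact s * z * of_real b ^ s) = norm (pochhammer q s) / fact s * norm z * b ^ s"
    using assms(3) by (simp add: norm_mult norm_divide norm_power)
  also have "\<dots> \<le> pochhammer R s / fact s * (C * (real s + 1)\<^sup>2) * r ^ s"
    using assms P P0 C0 by (intro mult_mono divide_right_mono power_mono) auto
  finally show ?thesis by (simp add: pochhammer_majorant_def mult_ac)
qed

lemma bump_int_1_bounds: "0 \<le> poly (bump_int s) 1" "poly (bump_int s) 1 \<le> 1"
proof -
  have "0 \<le> pochhammer (1::real) s" "pochhammer (1::real) s \<le> pochhammer (3 / 2) s \<and> 0 < pochhammer (3 / 2 :: real) s"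
    by (induction s) (auto simp: pochhammer_Suc intro!: mult_mono)
  then show "0 \<le> poly (bump_int s) 1" "poly (bump_int s) 1 \<le> 1"
    by (auto simp: poly_bump_int_1)
qed

text \<open>The quotient of the Pochhammer symbols of 1 and 3/2 is the integral of (1 - x^2)^s over
  [0, 1]. This puts the function in the same shape as the series of correction terms.\<close>

lemma gauss_2F1_eq:
  "gauss_2F1 1 q (3 / 2) z = (\<Sum>s. pochhammer q s / fact s * of_real (poly (bump_int s) 1) * z ^ s)"
proof -
  have "of_real (pochhammer x s) = (pochhammer (of_real x) s :: complex)" for x :: real and s
    by (induction s) (simp_all add: pochhammer_Suc)
  then show ?thesis
    by (simp add: gauss_2F1_def eval_fps_def poly_bump_int_1 mult_ac)
qed

lemma pochhammer_series_summable:
  assumes "0 \<le> b" "b < 1" and "\<And>s. norm (z s) \<le> C * (real s + 1)\<^sup>2"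
  shows "summable (\<lambda>s. norm (pochhammer q s / fact s * z s * of_real b ^ s :: complex))"
proof (rule summable_comparison_test'[where N = 0])
  \<comment> \<open>The radius is increased by 1 because the majorant needs \<open>R > 0\<close>,
    while \<open>q\<close> may be 0.\<close>
  show "summable (\<lambda>s. C * pochhammer_majorant (norm q + 1) b s)"
    using assms by (intro summable_mult summable_pochhammer_majorant) (auto intro: add_nonneg_pos)
  show "norm (norm (pochhammer q s / fact s * z s * of_real b ^ s)) \<le> C * pochhammer_majorant (norm q + 1) b s" for s
    using norm_pochhammer_term_le[of q "norm q + 1" "z s" C s b b] assms by simp
qed

lemma pochhammer_series_holomorphic:
  assumes b: "0 \<le> b" "b < 1" and S: "open S"
    and hol: "\<And>s. z s holomorphic_on S"
    and bound: "\<And>q. q \<in> S \<Longrightarrow> \<exists>d>0. \<exists>C. cball q d \<subseteq> S \<and>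
                  (\<forall>p\<in>cball q d. \<forall>s. norm (z s p) \<le> C * (real s + 1)\<^sup>2)"
  shows "(\<lambda>q. \<Sum>s. pochhammer q s / fact s * z s q * of_real b ^ s) holomorphic_on S"
proof (rule holomorphic_on_suminf_of_local_bound[OF S])
  have "(\<lambda>q. pochhammer q s) holomorphic_on S" for s
    by (induction s) (auto simp: pochhammer_Suc intro!: holomorphic_intros)
  then show "(\<lambda>q. pochhammer q s / fact s * z s q * of_real b ^ s) holomorphic_on S" for s
    by (intro holomorphic_intros hol) auto
  fix q assume "q \<in> S"
  from bound[OF this] obtain d C where d: "d > 0" "cball q d \<subseteq> S"
    and C: "\<And>p s. p \<in> cball q d \<Longrightarrow> norm (z s p) \<le> C * (real s + 1)\<^sup>2" by blast
  have "summable (\<lambda>s. C * pochhammer_majorant (norm q + d) b s)"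
    using b d by (intro summable_mult summable_pochhammer_majorant) (auto intro: add_nonneg_pos)
  moreover have "norm (pochhammer p s / fact s * z s p * of_real b ^ s) \<le> C * pochhammer_majorant (norm q + d) b s"
    if p: "p \<in> cball q d" for p s
  proof (rule norm_pochhammer_term_le)
    show "norm p \<le> norm q + d"
      using p norm_triangle_ineq3[of q p] by (simp add: dist_norm)
  qed (use C p b in auto)
  ultimately show "\<exists>d>0. \<exists>M. cball q d \<subseteq> S \<and> summable M \<and>
      (\<forall>s. \<forall>p\<in>cball q d. norm (pochhammer p s / fact s * z s p * of_real b ^ s) \<le> M s)"
    using d by blast
qed

section \<open>Dirichlet series with the trapezoidal errors as coefficients\<close>

definition zeta_err :: "nat \<Rightarrow> complex \<Rightarrow> complex" where
  "zeta_err s w = (\<Sum>n. of_nat (Suc n) powr (- w) * of_real (trap_err s (Suc n)))"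

text \<open>The decay 1/c of the trapezoidal error gains one power, so that the series converges for
  Re w > 0 with a bound quadratic in s.\<close>

lemma zeta_err_term_bound:
  assumes "\<sigma> \<le> Re w"
  shows "norm (of_nat (Suc n) powr (- w) * of_real (trap_err s (Suc n)) :: complex)
     \<le> 2 * (real s)\<^sup>2 * real (Suc n) powr (- \<sigma> - 1)"
proof -
  have "norm (of_nat (Suc n) powr (- w) * of_real (trap_err s (Suc n)) :: complex)
      = real (Suc n) powr (- Re w) * \<bar>trap_err s (Suc n)\<bar>"
    unfolding norm_mult norm_nat_powr by simp
  also have "\<dots> \<le> real (Suc n) powr (- \<sigma>) * (2 * (real s)\<^sup>2 / real (Suc n))"
    using assms trap_err_bound[of s "Suc n"] by (intro mult_mono powr_mono) auto
  also have "\<dots> = 2 * (real s)\<^sup>2 * (real (Suc n) powr (- \<sigma>) * real (Suc n) powr (- 1))"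
    by (simp add: powr_minus_divide)
  finally show ?thesis unfolding powr_add[symmetric] by simp
qed

lemma summable_zeta_err:
  assumes "0 < Re w"
  shows "summable (\<lambda>n. norm (of_nat (Suc n) powr (- w) * of_real (trap_err s (Suc n)) :: complex))"
proof (rule summable_comparison_test'[where N = 0])
  show "summable (\<lambda>n. 2 * (real s)\<^sup>2 * real (Suc n) powr (- Re w - 1))"
    using assms by (intro summable_mult summable_Suc_powr) auto
  show "norm (norm (of_nat (Suc n) powr (- w) * of_real (trap_err s (Suc n)) :: complex))
      \<le> 2 * (real s)\<^sup>2 * real (Suc n) powr (- Re w - 1)" for n
    using zeta_err_term_bound[of "Re w" w n s] by simp
qed

lemma zeta_err_bound:
  assumes "0 < \<sigma>" "\<sigma> \<le> Re w"
  shows "norm (zeta_err s w) \<le> 2 * (\<Sum>n. real (Suc n) powr (- \<sigma> - 1)) * (real s + 1)\<^sup>2"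
proof -
  let ?Z = "\<Sum>n. real (Suc n) powr (- \<sigma> - 1)"
  have sm: "summable (\<lambda>n. real (Suc n) powr (- \<sigma> - 1))"
    using assms by (intro summable_Suc_powr) auto
  have "norm (zeta_err s w) \<le> (\<Sum>n. 2 * (real s)\<^sup>2 * real (Suc n) powr (- \<sigma> - 1))"
    unfolding zeta_err_def
    by (rule norm_suminf_le[OF zeta_err_term_bound[OF assms(2)] summable_mult[OF sm]])
  also have "\<dots> = 2 * ?Z * (real s)\<^sup>2"
    unfolding suminf_mult[OF sm] by (simp only: mult_ac)
  also have "\<dots> \<le> 2 * ?Z * (real s + 1)\<^sup>2"
    using suminf_nonneg[OF sm] by (intro mult_left_mono power_mono) auto
  finally show ?thesis .
qed

lemma zeta_err_holomorphic: "zeta_err s holomorphic_on {w. 0 < Re w}"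
  unfolding zeta_err_def
proof (rule holomorphic_on_suminf_of_local_bound)
  show op: "open {w::complex. 0 < Re w}" by (rule open_halfspace_Re_gt)
  show "(\<lambda>w. of_nat (Suc n) powr (- w) * of_real (trap_err s (Suc n))) holomorphic_on {w. 0 < Re w}" for n
    by (intro holomorphic_intros)
  fix z :: complex assume z: "z \<in> {w. 0 < Re w}"
  then have "0 < Re z" by simp
  then obtain d where d: "d > 0" "cball z d \<subseteq> {w. 0 < Re w}"
      "\<And>w. w \<in> cball z d \<Longrightarrow> 0 < Re z - d \<and> Re z - d \<le> Re w"
      "\<And>w. w \<in> cball z d \<Longrightarrow> norm w \<le> norm z + d"
    by (rule cball_half_plane[OF _ op z]) (rule that)
  have "0 < Re z - d" using d(3)[of z] d(1) by simp
  define M where "M n = 2 * (real s)\<^sup>2 * real (Suc n) powr (- (Re z - d) - 1)" for n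
  have "summable M"
    unfolding M_def using \<open>0 < Re z - d\<close> by (intro summable_mult summable_Suc_powr) auto
  moreover have "norm (of_nat (Suc n) powr (- w) * of_real (trap_err s (Suc n)) :: complex) \<le> M n"
    if "w \<in> cball z d" for n w
    unfolding M_def using d(3)[OF that] by (intro zeta_err_term_bound) simp
  ultimately show "\<exists>d>0. \<exists>M. cball z d \<subseteq> {w. 0 < Re w} \<and> summable M \<and>
      (\<forall>n. \<forall>w\<in>cball z d. norm (of_nat (Suc n) powr (- w) * of_real (trap_err s (Suc n)) :: complex) \<le> M n)"
    using d(1,2) by (intro exI[of _ d] exI[of _ M]) auto
qed

lemma zeta_err_0: "zeta_err 0 w = 0"
  by (simp add: zeta_err_def trap_err_0)

text \<open>Insert \<open>trap_err_eq\<close> and sum over n: each power of 1/(n + 1) shifts the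
  exponent of the Dirichlet series. As s, k >= 1, every argument w - 1 + s + k has real part above
  1, so the plain zeta series applies.\<close>

lemma zeta_err_eq:
  assumes w: "0 < Re w" and s: "s > 0"
  shows "zeta_err s w = 2 ^ Suc s * (\<Sum>k = 1..s. of_nat (s choose (k - 1)) * (- 1) ^ k / (2 ^ k * of_nat (s + k)) *
        of_real (bernoulli_number (s + k)) * riemann_zeta (w - 1 + of_nat s + of_nat k))"
proof -
  define C :: "nat \<Rightarrow> complex" where
    "C k = of_nat (s choose (k - 1)) * (- 1) ^ k / (2 ^ k * of_nat (s + k)) * of_real (bernoulli_number (s + k))" for k
  have "(\<lambda>n. 2 ^ Suc s * (\<Sum>k=1..s. C k * of_nat (Suc n) powr (- (w - 1 + of_nat s + of_nat k)))) sums
      (2 ^ Suc s * (\<Sum>k=1..s. C k * riemann_zeta (w - 1 + of_nat s + of_nat k)))"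
    using w s by (intro sums_mult sums_sum riemann_zeta_sums) auto
  moreover have "2 ^ Suc s * (\<Sum>k=1..s. C k * of_nat (Suc n) powr (- (w - 1 + of_nat s + of_nat k)))
      = of_nat (Suc n) powr (- w) * of_real (trap_err s (Suc n))" for n
  proof -
    have pw: "of_nat (Suc n) powr (- (w - 1 + of_nat s + of_nat k))
        = of_nat (Suc n) powr (- w) * of_real (1 / real (Suc n)) ^ (s + k - 1)" if "k \<in> {1..s}" for k
    proof -
      have "- (w - 1 + of_nat s + of_nat k) = - w - of_nat (s + k - 1)"
        using that by (simp add: of_nat_diff)
      then have "of_nat (Suc n) powr (- (w - 1 + of_nat s + of_nat k))
        = of_nat (Suc n) powr (- w) / of_nat (Suc n) powr of_nat (s + k - 1)"
        by (simp only: powr_diff)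
      also have "of_nat (Suc n) powr of_nat (s + k - 1) = (of_nat (Suc n) ^ (s + k - 1) :: complex)"
        by (rule powr_nat') (simp del: of_nat_Suc)
      finally show ?thesis by (simp add: power_one_over del: of_nat_Suc)
    qed
    have "of_real (trap_err s (Suc n)) = 2 ^ Suc s * (\<Sum>k=1..s. C k * of_real (1 / real (Suc n)) ^ (s + k - 1))"
      unfolding trap_err_eq[OF zero_less_Suc s] by (simp add: C_def del: of_nat_Suc of_nat_add)
    moreover have "2 ^ Suc s * (\<Sum>k=1..s. C k * of_nat (Suc n) powr (- (w - 1 + of_nat s + of_nat k)))
        = 2 ^ Suc s * (\<Sum>k=1..s. of_nat (Suc n) powr (- w) * (C k * of_real (1 / real (Suc n)) ^ (s + k - 1)))"
      by (intro arg_cong[where f = "\<lambda>x. 2 ^ Suc s * x"] sum.cong refl) (simp only: pw mult_ac)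
    ultimately show ?thesis
      unfolding sum_distrib_left[symmetric] by (simp only: mult_ac)
  qed
  ultimately show ?thesis
    unfolding zeta_err_def C_def by (simp only: sums_iff)
qed

text \<open>Up to the factor (y/(1 + y^2))^q, this continues the sum over the lattice points on one
  side of the diagonal, with boundary points weighted one half. The value of \<open>b\<close>, 1/(1
  + y^2) or y^2/(1 + y^2), selects the side.\<close>

definition half_eisenstein :: "complex \<Rightarrow> real \<Rightarrow> complex" where
  "half_eisenstein q b = riemann_zeta (2 * q - 1) * gauss_2F1 1 q (3 / 2) (of_real b) +
     (\<Sum>s. pochhammer q s / fact s * zeta_err s (2 * q) * of_real b ^ s)"

lemma one_le_square_Suc: "1 \<le> (real s + 1)\<^sup>2"
  by (simp add: power2_eq_square algebra_simps)

lemma half_eisenstein_holomorphic: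
  assumes b: "0 \<le> b" "b < 1"
  shows "(\<lambda>q. half_eisenstein q b) holomorphic_on ({q. 0 < Re q} - {1})" (is "_ holomorphic_on ?S")
proof -
  have op: "open ?S" by (intro open_delete open_halfspace_Re_gt)
  \<comment> \<open>The map q to 2q - 1 carries Re q > 0 without 1 into Re w > -1 without 1.\<close>
  have "(riemann_zeta \<circ> (\<lambda>q. 2 * q - 1)) holomorphic_on ?S"
    by (rule holomorphic_on_compose_gen[OF _ riemann_zeta_holomorphic]) (auto intro!: holomorphic_intros)
  then have 1: "(\<lambda>q. riemann_zeta (2 * q - 1)) holomorphic_on ?S"
    by (simp add: o_def)
  have 2: "(\<lambda>q. gauss_2F1 1 q (3 / 2) (of_real b)) holomorphic_on ?S"
    unfolding gauss_2F1_eq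
  proof (rule pochhammer_series_holomorphic[OF b op])
    fix q assume "q \<in> ?S"
    then obtain d where "d > 0" "cball q d \<subseteq> ?S"
      using op open_contains_cball by blast
    moreover have "norm (of_real (poly (bump_int s) 1) :: complex) \<le> 1 * (real s + 1)\<^sup>2" for s
      using order_trans[OF bump_int_1_bounds(2) one_le_square_Suc] bump_int_1_bounds(1) by simp
    ultimately show "\<exists>d>0. \<exists>C. cball q d \<subseteq> ?S \<and>
        (\<forall>p\<in>cball q d. \<forall>s. norm (of_real (poly (bump_int s) 1) :: complex) \<le> C * (real s + 1)\<^sup>2)"
      by blast
  qed (rule holomorphic_on_const)
  have 3: "(\<lambda>q. \<Sum>s. pochhammer q s / fact s * zeta_err s (2 * q) * of_real b ^ s) holomorphic_on ?S"
  proof (rule pochhammer_series_holomorphic[OF b op])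
    fix s
    have "(zeta_err s \<circ> (\<lambda>q. 2 * q)) holomorphic_on ?S"
      by (rule holomorphic_on_compose_gen[OF _ zeta_err_holomorphic]) (auto intro!: holomorphic_intros)
    then show "(\<lambda>q. zeta_err s (2 * q)) holomorphic_on ?S"
      by (simp add: o_def)
  next
    fix q assume q: "q \<in> ?S"
    then have "0 < Re q" by simp
    then obtain d where d: "d > 0" "cball q d \<subseteq> ?S"
        "\<And>w. w \<in> cball q d \<Longrightarrow> 0 < Re q - d \<and> Re q - d \<le> Re w"
        "\<And>w. w \<in> cball q d \<Longrightarrow> norm w \<le> norm q + d"
      by (rule cball_half_plane[OF _ op q]) (rule that)
    define C where "C = 2 * (\<Sum>n. real (Suc n) powr (- (2 * (Re q - d)) - 1))"
    have "norm (zeta_err s (2 * p)) \<le> C * (real s + 1)\<^sup>2" if "p \<in> cball q d" for p s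
      unfolding C_def using d(3)[OF that] by (intro zeta_err_bound) auto
    then show "\<exists>d>0. \<exists>C. cball q d \<subseteq> ?S \<and>
        (\<forall>p\<in>cball q d. \<forall>s. norm (zeta_err s (2 * p)) \<le> C * (real s + 1)\<^sup>2)"
      using d(1,2) by (intro exI[of _ d] conjI exI[of _ C]) auto
  qed
  show ?thesis
    unfolding half_eisenstein_def by (intro holomorphic_on_add holomorphic_on_mult 1 2 3)
qed

section \<open>Binomial expansion of the trapezoidal sums\<close>

lemma trapezoid_sums:
  assumes "\<And>x. x \<in> {0..1} \<Longrightarrow> (\<lambda>s. f s x) sums F x"
  shows "(\<lambda>s. trapezoid c (f s)) sums trapezoid c F"
  unfolding trapezoid_def
  by (intro sums_sum sums_scaleR_right sums_add assms) auto

lemma trapezoid_mult_of_real: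
  fixes C :: complex
  shows "trapezoid c (\<lambda>x. C * of_real (g x)) = C * of_real (trapezoid c g)"
  unfolding trapezoid_def of_real_sum sum_distrib_left
  by (intro sum.cong refl) (simp add: scaleR_conv_of_real algebra_simps)

lemma trapezoid_mult_left:
  fixes C :: complex
  shows "C * trapezoid c f = trapezoid c (\<lambda>x. C * f x)"
  unfolding trapezoid_def sum_distrib_left
  by (intro sum.cong refl) (simp add: scaleR_conv_of_real algebra_simps)

lemma trapezoid_bump_bounds:
  "0 \<le> trapezoid c (\<lambda>x. (1 - x\<^sup>2) ^ s :: real)" "trapezoid c (\<lambda>x. (1 - x\<^sup>2) ^ s :: real) \<le> real c"
proof -
  have u: "0 \<le> (1 - x\<^sup>2) ^ s \<and> (1 - x\<^sup>2) ^ s \<le> 1" if "0 \<le> x" "x \<le> 1" for x :: real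
    using that by (auto intro!: zero_le_power power_le_one simp: power_le_one abs_square_le_1)
  have v: "0 \<le> (1 / 2) *\<^sub>R ((1 - (real d / real c)\<^sup>2) ^ s + (1 - (real (Suc d) / real c)\<^sup>2) ^ s) \<and>
      (1 / 2) *\<^sub>R ((1 - (real d / real c)\<^sup>2) ^ s + (1 - (real (Suc d) / real c)\<^sup>2) ^ s) \<le> 1" if "d < c" for d
  proof -
    have "real d / real c \<le> 1" "real (Suc d) / real c \<le> 1" using that by (auto simp: divide_le_eq_1)
    then show ?thesis using u[of "real d / real c"] u[of "real (Suc d) / real c"] by simp
  qed
  show "0 \<le> trapezoid c (\<lambda>x. (1 - x\<^sup>2) ^ s :: real)"
    unfolding trapezoid_def using v by (intro sum_nonneg) simp
  have "trapezoid c (\<lambda>x. (1 - x\<^sup>2) ^ s :: real) \<le> (\<Sum>d<c. 1)"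
    unfolding trapezoid_def using v by (intro sum_mono) simp
  then show "trapezoid c (\<lambda>x. (1 - x\<^sup>2) ^ s :: real) \<le> real c" by simp
qed

text \<open>The double series \<open>f n s\<close> is summed in both orders. Over s it is a binomial
  series and gives the trapezoidal sums; over n it splits into the integral times zeta(2q - 1) and
  the error series.\<close>

lemma half_eisenstein_trapezoid_sums:
  assumes q: "1 < Re q" and b: "0 \<le> b" "b < 1"
  shows "(\<lambda>n. of_nat (Suc n) powr (- (2 * q)) *
            trapezoid (Suc n) (\<lambda>x. of_real (1 - b * (1 - x\<^sup>2)) powr (- q))) sums half_eisenstein q b"
proof -
  define p :: "nat \<Rightarrow> complex" where "p n = of_nat (Suc n) powr (- (2 * q))" for n
  define t where "t n s = trapezoid (Suc n) (\<lambda>x. (1 - x\<^sup>2) ^ s :: real)" for n s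
  define \<beta> where "\<beta> s = pochhammer q s / fact s * of_real b ^ s" for s
  define f where "f n s = p n * of_real (t n s) * \<beta> s" for n s
  have norm_p: "norm (p n) * real (Suc n) = real (Suc n) powr (1 - 2 * Re q)" for n
    unfolding p_def norm_nat_powr by (simp add: powr_diff powr_minus divide_simps)
  have sum_p: "summable (\<lambda>n. norm (p n) * real (Suc n))"
    unfolding norm_p using q by (intro summable_Suc_powr) auto
  have t: "norm (of_real (t n s) :: complex) \<le> real (Suc n)" for n s
    using trapezoid_bump_bounds[of "Suc n" s] by (simp add: t_def)
  \<comment> \<open>The bound separates n from s, so absolute convergence reduces to two single
    series; the one over n, with terms (n + 1)^(1 - 2 Re q), requires Re q > 1.\<close>
  have nf: "norm (f n s) \<le> norm (p n) * real (Suc n) * norm (\<beta> s)" for n s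
    unfolding f_def norm_mult using t[of n s] by (intro mult_mono) auto
  have sum_\<beta>: "summable (\<lambda>s. norm (\<beta> s))"
    using pochhammer_series_summable[OF b, of "\<lambda>_. 1" 1 q] one_le_square_Suc by (simp add: \<beta>_def)
  have abs: "(\<lambda>(n, s). f n s) summable_on UNIV \<times> UNIV"
  proof (rule abs_summable_summable[OF Infinite_Sum.abs_summable_on_comparison_test'])
    show "(\<lambda>(n, s). norm (p n) * real (Suc n) * norm (\<beta> s)) summable_on UNIV \<times> UNIV"
    proof (rule summable_on_SigmaI)
      show "((\<lambda>s. case (n, s) of (n, s) \<Rightarrow> norm (p n) * real (Suc n) * norm (\<beta> s)) has_sum
          norm (p n) * real (Suc n) * (\<Sum>s. norm (\<beta> s))) UNIV" for n
        using sum_\<beta> unfolding prod.case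
        by (intro has_sum_cmult_right norm_summable_imp_has_sum summable_sums) auto
      show "(\<lambda>n. norm (p n) * real (Suc n) * (\<Sum>s. norm (\<beta> s))) summable_on UNIV"
        using summable_mult2[OF sum_p] suminf_nonneg[OF sum_\<beta>]
        by (subst summable_on_UNIV_nonneg_real_iff) auto
    qed auto
    show "norm (case x of (n, s) \<Rightarrow> f n s) \<le> (case x of (n, s) \<Rightarrow> norm (p n) * real (Suc n) * norm (\<beta> s))" for x
      using nf by (auto split: prod.splits)
  qed
  have row: "((\<lambda>s. f n s) has_sum p n * trapezoid (Suc n) (\<lambda>x. of_real (1 - b * (1 - x\<^sup>2)) powr (- q))) UNIV" for n
  proof (rule norm_summable_imp_has_sum)
    show "summable (\<lambda>s. norm (f n s))"
      using nf by (intro summable_comparison_test'[OF summable_mult[OF sum_\<beta>], of 0]) auto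
    have "(\<lambda>s. \<beta> s * of_real ((1 - x\<^sup>2) ^ s)) sums of_real (1 - b * (1 - x\<^sup>2)) powr (- q)"
      if x: "x \<in> {0..1}" for x :: real
    proof -
      define u where "u = b * (1 - x\<^sup>2)"
      have "0 \<le> 1 - x\<^sup>2" "1 - x\<^sup>2 \<le> 1" using x by (auto simp: power_le_one abs_square_le_1)
      then have "0 \<le> u" "u \<le> b"
        using b by (auto simp: u_def mult_left_le)
      then have "(\<lambda>s. ((- q) gchoose s) * (- of_real u) ^ s) sums (1 + (- of_real u)) powr (- q)"
        using b by (intro gen_binomial_complex) simp
      \<comment> \<open>The binomial coefficient of -q is (-1)^s times the Pochhammer symbol of q
        over s!, and its sign cancels that of (-u)^s.\<close>
      moreover have "((- q) gchoose s) * (- of_real u) ^ s = \<beta> s * of_real ((1 - x\<^sup>2) ^ s)" for s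
      proof -
        have "(- of_real u) ^ s = (- 1) ^ s * (of_real b ^ s * of_real ((1 - x\<^sup>2) ^ s) :: complex)"
          unfolding power_minus[of "of_real u"]
          by (simp only: u_def of_real_mult of_real_power power_mult_distrib)
        then show ?thesis
          by (simp add: gbinomial_pochhammer \<beta>_def flip: power_mult_distrib)
      qed
      moreover have "1 + (- of_real u) = (of_real (1 - b * (1 - x\<^sup>2)) :: complex)"
        by (simp add: u_def)
      ultimately show ?thesis by simp
    qed
    then have "(\<lambda>s. trapezoid (Suc n) (\<lambda>x. \<beta> s * of_real ((1 - x\<^sup>2) ^ s))) sums
        trapezoid (Suc n) (\<lambda>x. of_real (1 - b * (1 - x\<^sup>2)) powr (- q))"
      by (rule trapezoid_sums)
    then have "(\<lambda>s. \<beta> s * of_real (t n s)) sums trapezoid (Suc n) (\<lambda>x. of_real (1 - b * (1 - x\<^sup>2)) powr (- q))"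
      unfolding trapezoid_mult_of_real t_def .
    from sums_mult[OF this, of "p n"]
    show "(\<lambda>s. f n s) sums (p n * trapezoid (Suc n) (\<lambda>x. of_real (1 - b * (1 - x\<^sup>2)) powr (- q)))"
      by (simp add: f_def mult_ac)
  qed
  define G where "G s = pochhammer q s / fact s * of_real (poly (bump_int s) 1) * of_real b ^ s * riemann_zeta (2 * q - 1) +
      pochhammer q s / fact s * zeta_err s (2 * q) * of_real b ^ s" for s
  have col: "((\<lambda>n. f n s) has_sum G s) UNIV" for s
  proof (rule norm_summable_imp_has_sum)
    show "summable (\<lambda>n. norm (f n s))"
      using nf by (intro summable_comparison_test'[OF summable_mult2[OF sum_p], of 0]) auto
    have "(\<lambda>n. of_nat (Suc n) powr (- (2 * q - 1))) sums riemann_zeta (2 * q - 1)"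
      using q by (intro riemann_zeta_sums) auto
    moreover have "of_nat (Suc n) powr (- (2 * q - 1)) = p n * of_nat (Suc n)" for n
    proof -
      have "- (2 * q - 1) = - (2 * q) + 1" by simp
      then show ?thesis unfolding p_def by (simp only: powr_add) simp
    qed
    moreover have "(\<lambda>n. p n * of_real (trap_err s (Suc n))) sums zeta_err s (2 * q)"
      unfolding p_def zeta_err_def using q
      by (intro summable_sums[OF summable_norm_cancel[OF summable_zeta_err]]) simp
    ultimately have "(\<lambda>n. p n * of_nat (Suc n) * of_real (poly (bump_int s) 1) + p n * of_real (trap_err s (Suc n)))
        sums (riemann_zeta (2 * q - 1) * of_real (poly (bump_int s) 1) + zeta_err s (2 * q))"
      by (intro sums_add sums_mult2) simp_all
    \<comment> \<open>A trapezoidal sum is \<open>Suc n\<close> times the integral plus its error;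
      the factor \<open>Suc n\<close> turns the exponent 2q into 2q - 1.\<close>
    moreover have "p n * of_nat (Suc n) * of_real (poly (bump_int s) 1) + p n * of_real (trap_err s (Suc n))
        = p n * of_real (t n s)" for n
      by (simp add: trap_err_def t_def algebra_simps del: of_nat_Suc)
    ultimately have "(\<lambda>n. p n * of_real (t n s)) sums
        (riemann_zeta (2 * q - 1) * of_real (poly (bump_int s) 1) + zeta_err s (2 * q))"
      by simp
    from sums_mult2[OF this, of "\<beta> s"] show "(\<lambda>n. f n s) sums G s"
      by (simp add: f_def G_def \<beta>_def algebra_simps)
  qed
  have G: "(G has_sum half_eisenstein q b) UNIV"
  proof (rule norm_summable_imp_has_sum)
    have I: "summable (\<lambda>s. norm (pochhammer q s / fact s * of_real (poly (bump_int s) 1) * of_real b ^ s))"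
    proof (rule pochhammer_series_summable[OF b])
      show "norm (of_real (poly (bump_int s) 1) :: complex) \<le> 1 * (real s + 1)\<^sup>2" for s
        using order_trans[OF bump_int_1_bounds(2) one_le_square_Suc] bump_int_1_bounds(1) by simp
    qed
    have Z: "summable (\<lambda>s. norm (pochhammer q s / fact s * zeta_err s (2 * q) * of_real b ^ s))"
      by (rule pochhammer_series_summable[OF b, OF zeta_err_bound[of "Re (2 * q)" "2 * q"]]) (use q in auto)
    show "G sums half_eisenstein q b"
      unfolding G_def half_eisenstein_def gauss_2F1_eq mult.commute[of "riemann_zeta _"]
      by (intro sums_add sums_mult2 summable_sums summable_norm_cancel[OF I] summable_norm_cancel[OF Z])
    show "summable (\<lambda>s. norm (G s))"
    proof (rule summable_comparison_test'[where N = 0])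
      show "summable (\<lambda>s. norm (pochhammer q s / fact s * of_real (poly (bump_int s) 1) * of_real b ^ s) *
            norm (riemann_zeta (2 * q - 1)) +
            norm (pochhammer q s / fact s * zeta_err s (2 * q) * of_real b ^ s))"
        by (intro summable_add summable_mult2 I Z)
      show "norm (norm (G s)) \<le> norm (pochhammer q s / fact s * of_real (poly (bump_int s) 1) * of_real b ^ s) *
            norm (riemann_zeta (2 * q - 1)) +
            norm (pochhammer q s / fact s * zeta_err s (2 * q) * of_real b ^ s)" for s
        unfolding G_def norm_mult[symmetric] using norm_triangle_ineq by simp
    qed
  qed
  \<comment> \<open>The sums over n determine the total; after the swap, the sums over s must have
    the same total.\<close>
  have "((\<lambda>(s, n). f n s) has_sum half_eisenstein q b) (UNIV \<times> UNIV)"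
  proof (rule has_sum_SigmaI)
    show "((\<lambda>n. case (s, n) of (s, n) \<Rightarrow> f n s) has_sum G s) UNIV" for s
      using col by simp
    show "(G has_sum half_eisenstein q b) UNIV" by (rule G)
    show "(\<lambda>(s, n). f n s) summable_on UNIV \<times> UNIV"
      using abs unfolding summable_on_def
      by (subst (asm) has_sum_swap) simp
  qed
  then have "((\<lambda>(n, s). f n s) has_sum half_eisenstein q b) (UNIV \<times> UNIV)"
    by (subst has_sum_swap) simp
  from has_sum_SigmaD[OF this, of "\<lambda>n. p n * trapezoid (Suc n) (\<lambda>x. of_real (1 - b * (1 - x\<^sup>2)) powr (- q))"]
  have "((\<lambda>n. p n * trapezoid (Suc n) (\<lambda>x. of_real (1 - b * (1 - x\<^sup>2)) powr (- q))) has_sum half_eisenstein q b) UNIV"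
    using row by simp
  then show ?thesis unfolding p_def by (rule has_sum_imp_sums)
qed

subsection \<open>The lattice sum\<close>

definition lattice_term :: "real \<Rightarrow> complex \<Rightarrow> nat \<Rightarrow> nat \<Rightarrow> complex" where
  "lattice_term y q c d = of_real (y / ((real c)\<^sup>2 * y\<^sup>2 + (real d)\<^sup>2)) powr q"

text \<open>All bases are positive reals, so \<open>Ln\<close> is the real logarithm and the
  exponents combine without a change of branch.\<close>

lemma powr_quotient_real:
  assumes "0 < X" "0 < Y" "0 < Z"
  shows "of_real X powr q * of_real Y powr (- (2 * q)) * of_real Z powr (- q)
       = of_real (X / (Y\<^sup>2 * Z)) powr (q::complex)"
proof -
  have "ln (X / (Y\<^sup>2 * Z)) = ln X - (2 * ln Y + ln Z)"
    using assms by (simp add: ln_div ln_mult ln_realpow)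
  moreover have "X / (Y\<^sup>2 * Z) > 0" using assms by simp
  ultimately have "of_real (X / (Y\<^sup>2 * Z)) powr q = exp (q * of_real (ln X - (2 * ln Y + ln Z)))"
    using assms by (simp only: powr_def of_real_eq_0_iff Ln_of_real) simp
  then show ?thesis using assms
    by (simp only: powr_def of_real_eq_0_iff Ln_of_real exp_add[symmetric])
       (simp add: exp_add[symmetric] algebra_simps)
qed

text \<open>Grouping the lattice points by \<open>max c d\<close> makes the double sum a sum of trapezoidal sums:
  each point on an axis or on the diagonal is shared between two of them.\<close>

definition square_shell :: "nat \<Rightarrow> (nat \<times> nat) set" where
  "square_shell n = {(c, d). 1 \<le> c \<and> 1 \<le> d \<and> max c d = Suc n}"

lemma square_shell_eq: "square_shell n = {Suc n} \<times> {1..Suc n} \<union> {1..n} \<times> {Suc n}"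
  by (auto simp: square_shell_def max_def)

lemma finite_square_shell: "finite (square_shell n)"
  by (simp add: square_shell_eq)

lemma sum_square_shell:
  "(\<Sum>(c, d)\<in>square_shell n. f c d) = f (Suc n) (Suc n) + (\<Sum>d=1..n. f (Suc n) d) + (\<Sum>c=1..n. f c (Suc n))"
proof -
  have "(\<Sum>(c, d)\<in>square_shell n. f c d) =
      (\<Sum>(c, d)\<in>{Suc n} \<times> {1..Suc n}. f c d) + (\<Sum>(c, d)\<in>{1..n} \<times> {Suc n}. f c d)"
    unfolding square_shell_eq by (rule sum.union_disjoint) auto
  also have "\<dots> = (\<Sum>d=1..Suc n. f (Suc n) d) + (\<Sum>c=1..n. f c (Suc n))"
    by (simp only: sum.cartesian_product[symmetric]) simp
  finally show ?thesis by (simp add: add_ac)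
qed

text \<open>Shell n has at most 2(n + 1) points, so \<open>sB\<close> gives absolute summability.
  Regrouping is then legitimate, and the value is the sum over the shells.\<close>

lemma has_sum_quadrant_shells:
  fixes f :: "nat \<Rightarrow> nat \<Rightarrow> complex"
  assumes B: "\<And>n c d. (c, d) \<in> square_shell n \<Longrightarrow> norm (f c d) \<le> B n"
    and sB: "summable (\<lambda>n. real (Suc n) * B n)"
    and S: "(\<lambda>n. f (Suc n) (Suc n) + (\<Sum>d=1..n. f (Suc n) d) + (\<Sum>c=1..n. f c (Suc n))) sums S"
  shows "((\<lambda>(c, d). f c d) has_sum S) ({1..} \<times> {1..})"
proof -
  let ?g = "\<lambda>(n::nat, (c, d)). f c d"
  have B0: "0 \<le> B n" for n
    using order_trans[OF norm_ge_zero B[of "Suc n" "Suc n" n]] by (simp add: square_shell_def)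
  have card: "real (card (square_shell n)) \<le> 2 * real (Suc n)" for n
  proof -
    have "card (square_shell n) \<le> card ({Suc n} \<times> {1..Suc n}) + card ({1..n} \<times> {Suc n})"
      unfolding square_shell_eq by (rule card_Un_le)
    then show ?thesis by (simp add: card_cartesian_product)
  qed
  have shell_sum: "(\<Sum>(c, d)\<in>square_shell n. norm (f c d)) \<le> 2 * (real (Suc n) * B n)" for n
  proof -
    have "(\<Sum>(c, d)\<in>square_shell n. norm (f c d)) \<le> (\<Sum>(c, d)\<in>square_shell n. B n)"
      by (intro sum_mono) (auto intro: B)
    also have "\<dots> = real (card (square_shell n)) * B n" by simp
    also have "\<dots> \<le> 2 * real (Suc n) * B n"
      by (rule mult_right_mono[OF card B0])
    finally show ?thesis by (simp only: mult.assoc)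
  qed
  have abs: "?g summable_on Sigma UNIV square_shell"
  proof (rule abs_summable_summable, rule summable_on_SigmaI)
    show "((\<lambda>x. norm (?g (n, x))) has_sum (\<Sum>(c, d)\<in>square_shell n. norm (f c d))) (square_shell n)" for n
      using has_sum_finite[OF finite_square_shell, of "\<lambda>(c, d). norm (f c d)" n]
      by (simp add: case_prod_unfold)
    have nn: "0 \<le> (\<Sum>(c, d)\<in>square_shell n. norm (f c d))" for n
      by (intro sum_nonneg) auto
    show "(\<lambda>n. \<Sum>(c, d)\<in>square_shell n. norm (f c d)) summable_on UNIV"
      unfolding summable_on_UNIV_nonneg_real_iff[OF nn]
      using shell_sum nn
      by (intro summable_comparison_test'[OF summable_mult[OF sB, of 2], of 0]) simp
  qed auto
  have rows: "((\<lambda>x. ?g (n, x)) has_sum (f (Suc n) (Suc n) + (\<Sum>d=1..n. f (Suc n) d) + (\<Sum>c=1..n. f c (Suc n))))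
      (square_shell n)" for n
    using has_sum_finite[OF finite_square_shell, of "\<lambda>(c, d). f c d" n]
    by (simp add: sum_square_shell)
  have "((\<lambda>n. f (Suc n) (Suc n) + (\<Sum>d=1..n. f (Suc n) d) + (\<Sum>c=1..n. f c (Suc n))) has_sum
      infsum ?g (Sigma UNIV square_shell)) UNIV"
    by (rule has_sum_SigmaD[OF has_sum_infsum[OF abs] rows])
  then have "infsum ?g (Sigma UNIV square_shell) = S"
    using has_sum_imp_sums sums_unique2[OF _ S] by blast
  with has_sum_infsum[OF abs] have "(?g has_sum S) (Sigma UNIV square_shell)" by simp
  \<comment> \<open>Every point (c, d) of the quadrant lies in exactly one shell, that of index max
    c d - 1.\<close>
  moreover have "bij_betw snd (Sigma UNIV square_shell) ({1..} \<times> {1..})"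
  proof (rule bij_betwI[where g = "\<lambda>(c, d). (max c d - 1, (c, d))"])
  qed (auto simp: square_shell_def)
  from has_sum_reindex_bij_betw[OF this, of "\<lambda>(c, d). f c d" S]
  have "(?g has_sum S) (Sigma UNIV square_shell) = ((\<lambda>(c, d). f c d) has_sum S) ({1..} \<times> {1..})"
    by (simp add: case_prod_unfold)
  ultimately show ?thesis by simp
qed

text \<open>One coordinate equals n + 1 on the shell, so the denominator is at least min(1, y^2) (n
  + 1)^2.\<close>

lemma norm_lattice_term_le:
  assumes "0 < y" "0 < Re q" "(c, d) \<in> square_shell n"
  shows "norm (lattice_term y q c d) \<le> (y / min 1 (y\<^sup>2)) powr Re q * real (Suc n) powr (- (2 * Re q))"
proof -
  define m where "m = min 1 (y\<^sup>2)"
  have m: "0 < m" "m \<le> 1" "m \<le> y\<^sup>2" using assms(1) by (auto simp: m_def)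
  have "m * (real (Suc n))\<^sup>2 \<le> (real c)\<^sup>2 * y\<^sup>2 + (real d)\<^sup>2"
  proof (cases "c = Suc n")
    case True
    have "m * (real (Suc n))\<^sup>2 \<le> y\<^sup>2 * (real (Suc n))\<^sup>2" using m by (intro mult_right_mono) auto
    then show ?thesis using True by (simp add: mult.commute add_increasing2 del: of_nat_Suc)
  next
    case False
    then have "d = Suc n" using assms(3) by (auto simp: square_shell_eq)
    moreover have "m * (real (Suc n))\<^sup>2 \<le> 1 * (real (Suc n))\<^sup>2" using m by (intro mult_right_mono) auto
    ultimately show ?thesis by (simp add: add_increasing del: of_nat_Suc)
  qed
  moreover have "0 < m * (real (Suc n))\<^sup>2" using m by simp
  ultimately have le: "y / ((real c)\<^sup>2 * y\<^sup>2 + (real d)\<^sup>2) \<le> y / (m * (real (Suc n))\<^sup>2)"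
    and nn: "0 \<le> y / ((real c)\<^sup>2 * y\<^sup>2 + (real d)\<^sup>2)"
    using assms(1) by (auto intro!: divide_left_mono mult_pos_pos)
  have "norm (lattice_term y q c d) = (y / ((real c)\<^sup>2 * y\<^sup>2 + (real d)\<^sup>2)) powr Re q"
    unfolding lattice_term_def using nn by (subst norm_powr_real_powr) auto
  also have "\<dots> \<le> (y / (m * (real (Suc n))\<^sup>2)) powr Re q"
    using le nn assms(2) by (intro powr_mono2) auto
  also have "\<dots> = (y / m) powr Re q * (1 / (real (Suc n))\<^sup>2) powr Re q"
    using m assms(1) by (subst powr_mult[symmetric]) auto
  also have "(1 / (real (Suc n))\<^sup>2) powr Re q = (real (Suc n) powr (- 2)) powr Re q"
    by (simp add: powr_minus_divide)
  also have "\<dots> = real (Suc n) powr (- (2 * Re q))"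
    by (simp add: powr_powr)
  finally show ?thesis by (simp add: m_def)
qed

text \<open>At the node x = d/c one has c^2 (1 - b (1 - x^2)) = c^2 (1 - b) + b d^2, a quadratic
  form in (c, d). The half-weighted endpoints are the axis point d = 0 and the diagonal point d =
  c.\<close>

lemma trapezoid_eq_lattice_sum:
  assumes "0 < X" "0 < b" "b < 1"
  shows "of_real X powr q * (of_nat (Suc n) powr (- (2 * q)) *
            trapezoid (Suc n) (\<lambda>x. of_real (1 - b * (1 - x\<^sup>2)) powr (- q))) =
    1 / 2 * of_real (X / ((real (Suc n))\<^sup>2 * (1 - b))) powr q
    + 1 / 2 * of_real (X / (real (Suc n))\<^sup>2) powr q
    + (\<Sum>d=1..n. of_real (X / ((real (Suc n))\<^sup>2 * (1 - b) + b * (real d)\<^sup>2)) powr (q::complex))"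
proof -
  define h where "h x = of_real (X / ((real (Suc n))\<^sup>2 * (1 - b * (1 - x\<^sup>2)))) powr q" for x
  have "of_real X powr q * of_nat (Suc n) powr (- (2 * q)) * of_real (1 - b * (1 - x\<^sup>2)) powr (- q) = h x" for x
  proof -
    have "b * (1 - x\<^sup>2) \<le> b * 1" using assms by (intro mult_left_mono) auto
    then have "0 < 1 - b * (1 - x\<^sup>2)" using assms(3) by linarith
    from powr_quotient_real[OF assms(1) _ this, of "real (Suc n)" q] show ?thesis
      by (simp add: h_def del: of_nat_Suc)
  qed
  then have "of_real X powr q * (of_nat (Suc n) powr (- (2 * q)) *
            trapezoid (Suc n) (\<lambda>x. of_real (1 - b * (1 - x\<^sup>2)) powr (- q))) = trapezoid (Suc n) h"
    unfolding mult.assoc[symmetric] trapezoid_mult_left by simp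
  also have "\<dots> = 1 / 2 * h 0 + 1 / 2 * h 1 + (\<Sum>d=1..n. h (real d / real (Suc n)))"
    by (simp add: trapezoid_eq_inner_sum scaleR_conv_of_real atLeastLessThanSuc_atLeastAtMost del: of_nat_Suc)
  also have "(real (Suc n))\<^sup>2 * (1 - b * (1 - (real d / real (Suc n))\<^sup>2))
      = (real (Suc n))\<^sup>2 * (1 - b) + b * (real d)\<^sup>2" for d
    by (simp add: power_divide right_diff_distrib del: of_nat_Suc)
  then have "(\<Sum>d=1..n. h (real d / real (Suc n))) =
      (\<Sum>d=1..n. of_real (X / ((real (Suc n))\<^sup>2 * (1 - b) + b * (real d)\<^sup>2)) powr q)"
    by (simp only: h_def)
  finally show ?thesis by (simp add: h_def del: of_nat_Suc)
qed

lemma zeta_powr_sums: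
  assumes "1 < Re q" "0 < X"
  shows "(\<lambda>n. of_real (X / (real (Suc n))\<^sup>2) powr q) sums (riemann_zeta (2 * q) * of_real X powr q)"
proof -
  have "(\<lambda>n. of_nat (Suc n) powr (- (2 * q)) * of_real X powr q) sums (riemann_zeta (2 * q) * of_real X powr q)"
    using assms by (intro sums_mult2 riemann_zeta_sums) simp
  moreover have "of_nat (Suc n) powr (- (2 * q)) * of_real X powr q = of_real (X / (real (Suc n))\<^sup>2) powr q" for n
    using powr_quotient_real[OF assms(2), of "real (Suc n)" 1 q] by (simp add: mult.commute del: of_nat_Suc)
  ultimately show ?thesis by simp
qed

text \<open>\<open>u\<close> yields the points with d <= c, \<open>v\<close> those with c <= d. The
  two half diagonals combine into the full one. The half axes are halves of zeta series, and after
  doubling they account exactly for zeta(2q) (y^q + y^(-q)).\<close>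

lemma eisenstein_half_plane:
  assumes q: "1 < Re q" and y: "0 < y"
  shows "riemann_zeta (2 * q) * (of_real y powr q + of_real y powr (- q)) +
     2 * (\<Sum>\<^sub>\<infinity>(c, d) \<in> {1::nat..} \<times> {1::nat..}.
            of_real (y / ((real c)\<^sup>2 * y\<^sup>2 + (real d)\<^sup>2)) powr q)
    = 2 * of_real (y / (1 + y\<^sup>2)) powr q * (half_eisenstein q (1 / (1 + y\<^sup>2)) + half_eisenstein q (y\<^sup>2 / (1 + y\<^sup>2)))"
proof -
  define \<kappa> where "\<kappa> = y / (1 + y\<^sup>2)"
  define u where "u = 1 / (1 + y\<^sup>2)"
  define v where "v = y\<^sup>2 / (1 + y\<^sup>2)"
  let ?H = "of_real \<kappa> powr q * half_eisenstein q u" and ?H' = "of_real \<kappa> powr q * half_eisenstein q v"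
  have y2: "0 < 1 + y\<^sup>2" using y by (simp add: add_pos_nonneg)
  have \<kappa>: "\<kappa> > 0" "\<kappa> = y * u" using y y2 by (simp_all add: \<kappa>_def u_def)
  have uv: "0 < u" "u < 1" "0 < v" "v < 1" "1 - u = v" "1 - v = u" "v = y\<^sup>2 * u"
    using y y2 by (simp_all add: u_def v_def field_simps)
  let ?D = "\<lambda>n. of_real (\<kappa> / (real (Suc n))\<^sup>2) powr q :: complex"
  have cancel: "y * u / (N * (y\<^sup>2 * u) + u * D) = y / (N * y\<^sup>2 + D)"
    "y * u / (N * u + y\<^sup>2 * u * D) = y / (D * y\<^sup>2 + N)" for N D :: real
  proof -
    have "N * (y\<^sup>2 * u) + u * D = (N * y\<^sup>2 + D) * u" "N * u + y\<^sup>2 * u * D = (D * y\<^sup>2 + N) * u"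
      by (simp_all add: algebra_simps)
    then show "y * u / (N * (y\<^sup>2 * u) + u * D) = y / (N * y\<^sup>2 + D)"
      "y * u / (N * u + y\<^sup>2 * u * D) = y / (D * y\<^sup>2 + N)"
      using uv(1) by simp_all
  qed
  have "(\<lambda>n. of_real \<kappa> powr q * (of_nat (Suc n) powr (- (2 * q)) *
            trapezoid (Suc n) (\<lambda>x. of_real (1 - u * (1 - x\<^sup>2)) powr (- q)))) sums ?H"
    using uv by (intro sums_mult half_eisenstein_trapezoid_sums q) auto
  then have "(\<lambda>n. 1 / 2 * of_real (\<kappa> / ((real (Suc n))\<^sup>2 * v)) powr q + 1 / 2 * ?D n
      + (\<Sum>d=1..n. of_real (\<kappa> / ((real (Suc n))\<^sup>2 * v + u * (real d)\<^sup>2)) powr q)) sums ?H"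
    unfolding trapezoid_eq_lattice_sum[OF \<kappa>(1) uv(1) uv(2)] uv(5) .
  \<comment> \<open>The axis terms of this half produce y^(-q) zeta(2q); those of the other half
    produce y^q zeta(2q).\<close>
  moreover have "\<kappa> / (N * v) = (1 / y) / N" "\<kappa> / (N * v + u * D) = y / (N * y\<^sup>2 + D)" for N D :: real
    unfolding \<kappa>(2) uv(7) cancel using y uv(1) by (simp_all add: power2_eq_square)
  ultimately have A: "(\<lambda>n. 1 / 2 * of_real ((1 / y) / (real (Suc n))\<^sup>2) powr q + 1 / 2 * ?D n
      + (\<Sum>d=1..n. lattice_term y q (Suc n) d)) sums ?H"
    by (simp only: lattice_term_def)
  have "(\<lambda>n. of_real \<kappa> powr q * (of_nat (Suc n) powr (- (2 * q)) *
            trapezoid (Suc n) (\<lambda>x. of_real (1 - v * (1 - x\<^sup>2)) powr (- q)))) sums ?H'"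
    using uv by (intro sums_mult half_eisenstein_trapezoid_sums q) auto
  then have "(\<lambda>n. 1 / 2 * of_real (\<kappa> / ((real (Suc n))\<^sup>2 * u)) powr q + 1 / 2 * ?D n
      + (\<Sum>d=1..n. of_real (\<kappa> / ((real (Suc n))\<^sup>2 * u + v * (real d)\<^sup>2)) powr q)) sums ?H'"
    unfolding trapezoid_eq_lattice_sum[OF \<kappa>(1) uv(3) uv(4)] uv(6) .
  moreover have "\<kappa> / (N * u) = y / N" "\<kappa> / (N * u + v * D) = y / (D * y\<^sup>2 + N)" for N D :: real
    unfolding \<kappa>(2) uv(7) cancel using y uv(1) by simp_all
  ultimately have B: "(\<lambda>n. 1 / 2 * of_real (y / (real (Suc n))\<^sup>2) powr q + 1 / 2 * ?D n
      + (\<Sum>c=1..n. lattice_term y q c (Suc n))) sums ?H'"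
    by (simp only: lattice_term_def)
  have Z: "(\<lambda>n. 1 / 2 * of_real ((1 / y) / (real (Suc n))\<^sup>2) powr q) sums
        (1 / 2 * (riemann_zeta (2 * q) * of_real (1 / y) powr q))"
    "(\<lambda>n. 1 / 2 * of_real (y / (real (Suc n))\<^sup>2) powr q) sums
        (1 / 2 * (riemann_zeta (2 * q) * of_real y powr q))"
    using y by (intro sums_mult zeta_powr_sums q; simp)+
  define S where "S = ?H - 1 / 2 * (riemann_zeta (2 * q) * of_real (1 / y) powr q) +
      (?H' - 1 / 2 * (riemann_zeta (2 * q) * of_real y powr q))"
  have diag: "?D n = lattice_term y q (Suc n) (Suc n)" for n
  proof -
    have "\<kappa> / N = y / (N * y\<^sup>2 + N)" for N :: real
    proof -
      have "N * y\<^sup>2 + N = N * (1 + y\<^sup>2)" by (simp add: algebra_simps)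
      then show ?thesis by (simp add: \<kappa>_def)
    qed
    then show ?thesis by (simp only: lattice_term_def)
  qed
  have halves: "(1 / 2 * z + 1 / 2 * D + X - 1 / 2 * z) + (1 / 2 * z' + 1 / 2 * D + Y - 1 / 2 * z') = D + X + Y"
    for z z' D X Y :: complex
    by (simp add: field_simps)
  have "(\<lambda>n. lattice_term y q (Suc n) (Suc n) + (\<Sum>d=1..n. lattice_term y q (Suc n) d)
        + (\<Sum>c=1..n. lattice_term y q c (Suc n))) sums S"
    using sums_add[OF sums_diff[OF A Z(1)] sums_diff[OF B Z(2)]]
    unfolding halves S_def[symmetric] diag .
  moreover have "summable (\<lambda>n. real (Suc n) * ((y / min 1 (y\<^sup>2)) powr Re q * real (Suc n) powr (- (2 * Re q))))"
  proof -
    have "summable (\<lambda>n. (y / min 1 (y\<^sup>2)) powr Re q * real (Suc n) powr (1 - 2 * Re q))"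
      using q by (intro summable_mult summable_Suc_powr) auto
    moreover have "real (Suc n) powr (1 - 2 * Re q) = real (Suc n) * real (Suc n) powr (- (2 * Re q))" for n
      by (simp add: powr_diff powr_minus divide_simps)
    ultimately show ?thesis by (simp add: mult_ac del: of_nat_Suc)
  qed
  ultimately have "((\<lambda>(c, d). lattice_term y q c d) has_sum S) ({1..} \<times> {1..})"
    using norm_lattice_term_le[OF y] q
    by (intro has_sum_quadrant_shells[where B = "\<lambda>n. (y / min 1 (y\<^sup>2)) powr Re q * real (Suc n) powr (- (2 * Re q))"]) auto
  then have "(\<Sum>\<^sub>\<infinity>(c, d) \<in> {1::nat..} \<times> {1::nat..}.
            of_real (y / ((real c)\<^sup>2 * y\<^sup>2 + (real d)\<^sup>2)) powr q) = S"
    unfolding lattice_term_def by (rule infsumI)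
  moreover have "of_real (1 / y) powr q = (of_real y powr (- q) :: complex)"
    using powr_quotient_real[of 1 1 y q] y by simp
  moreover have "\<zeta> * (A + A') + 2 * (K * h - 1 / 2 * (\<zeta> * A') + (K * h' - 1 / 2 * (\<zeta> * A))) = 2 * K * (h + h')"
    for \<zeta> A A' K h h' :: complex
    by (simp add: algebra_simps)
  ultimately show ?thesis
    unfolding u_def[symmetric] v_def[symmetric] \<kappa>_def[symmetric] by (simp only: S_def)
qed

text \<open>The error series carries 2^(s + 1) where the term has 2^s, hence the factors 1/2. The
  last factor of the term splits into the s-th powers of the two bases.\<close>

lemma eisenstein_series_term_eq:
  assumes q: "0 < Re q" and s: "s > 0"
  shows "eisenstein_series_term q y s =
    1 / 2 * (pochhammer q s / fact s * zeta_err s (2 * q) * of_real (1 / (1 + y\<^sup>2)) ^ s) +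
    1 / 2 * (pochhammer q s / fact s * zeta_err s (2 * q) * of_real (y\<^sup>2 / (1 + y\<^sup>2)) ^ s)"
proof -
  define Z where "Z = (\<Sum>k = 1..s. of_nat (s choose (k - 1)) * (- 1) ^ k / (2 ^ k * of_nat (s + k)) *
        of_real (bernoulli_number (s + k)) * riemann_zeta (2 * q - 1 + of_nat s + of_nat k))"
  have Z: "zeta_err s (2 * q) = 2 ^ Suc s * Z"
    using zeta_err_eq[of "2 * q" s] q s by (simp add: Z_def)
  have "q \<notin> \<int>\<^sub>\<le>\<^sub>0" using q by (auto elim!: nonpos_Ints_cases)
  then have P: "pochhammer q s = Gamma (of_nat s + q) / Gamma q"
    by (simp add: pochhammer_Gamma add.commute)
  have "(1 + y ^ (2 * s)) / (1 + y\<^sup>2) ^ s = (1 / (1 + y\<^sup>2)) ^ s + (y\<^sup>2 / (1 + y\<^sup>2)) ^ s"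
    by (simp add: power_divide power_mult add_divide_distrib)
  then have "of_real ((1 + y ^ (2 * s)) / (1 + y\<^sup>2) ^ s)
      = (of_real (1 / (1 + y\<^sup>2)) ^ s + of_real (y\<^sup>2 / (1 + y\<^sup>2)) ^ s :: complex)"
    by (simp only: of_real_add of_real_power)
  then show ?thesis
    unfolding eisenstein_series_term_def Z_def[symmetric] Z P
    by (simp only:) (simp add: algebra_simps add_divide_distrib)
qed

theorem theoremC:
  fixes q :: complex
  assumes "Re q > 0" and "q \<noteq> 1"
  shows "(\<forall>y::real. y > 0 \<longrightarrow>
            eisenstein_imag y q =
              2 * of_real (y / (1 + y\<^sup>2)) powr q *
                (riemann_zeta (2 * q - 1) * gauss_2F1 1 q (3 / 2) (of_real (1 / (1 + y\<^sup>2))) +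
                 riemann_zeta (2 * q - 1) * gauss_2F1 1 q (3 / 2) (of_real (y\<^sup>2 / (1 + y\<^sup>2)))) +
              4 * of_real (y / (1 + y\<^sup>2)) powr q *
                (\<Sum>s. eisenstein_series_term q y (Suc s))) \<and>
         (\<forall>a b::real. 0 < a \<and> a \<le> b \<longrightarrow>
            uniform_limit {a..b} (\<lambda>N y. \<Sum>s = 1..N. eisenstein_series_term q y s)
              (\<lambda>y. \<Sum>s. eisenstein_series_term q y (Suc s)) sequentially)"
proof (intro conjI allI impI)
  fix y :: real assume y: "y > 0"
  define u where "u = 1 / (1 + y\<^sup>2)"
  define v where "v = y\<^sup>2 / (1 + y\<^sup>2)"
  let ?\<kappa> = "y / (1 + y\<^sup>2)"
  have y2: "0 < 1 + y\<^sup>2" using y by (simp add: add_pos_nonneg)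
  have uv: "0 \<le> u" "u < 1" "0 \<le> v" "v < 1"
    using y y2 by (simp_all add: u_def v_def)
  have \<kappa>: "?\<kappa> > 0" using y y2 by simp
  \<comment> \<open>Uniqueness of the continuation with \<open>\<sigma> = 0\<close>: the right-hand
    side is holomorphic on Re q > 0 without 1 and agrees with the defining series for Re q >
    1.\<close>
  have "eisenstein_imag y q = 2 * of_real ?\<kappa> powr q * (half_eisenstein q u + half_eisenstein q v)"
    unfolding eisenstein_imag_def
  proof (rule continuation_off_1_eqI)
    show "(\<lambda>q. 2 * of_real ?\<kappa> powr q * (half_eisenstein q u + half_eisenstein q v)) holomorphic_on ({z. 0 < Re z} - {1})"
      using uv \<kappa> by (intro holomorphic_on_mult holomorphic_on_add half_eisenstein_holomorphic) (auto intro!: holomorphic_intros)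
  qed (use assms eisenstein_half_plane[OF _ y] in \<open>auto simp: u_def v_def\<close>)
  moreover have "(\<Sum>s. eisenstein_series_term q y (Suc s)) =
      1 / 2 * ((\<Sum>s. pochhammer q s / fact s * zeta_err s (2 * q) * of_real u ^ s) +
       (\<Sum>s. pochhammer q s / fact s * zeta_err s (2 * q) * of_real v ^ s))" (is "_ = 1 / 2 * (?U + ?V)")
  proof -
    let ?t = "\<lambda>x s. pochhammer q s / fact s * zeta_err s (2 * q) * of_real x ^ s"
    have sum: "?t x sums suminf (?t x)" if "0 \<le> x" "x < 1" for x
    proof -
      have "summable (\<lambda>s. norm (?t x s))"
        by (rule pochhammer_series_summable[OF that, OF zeta_err_bound[of "Re (2 * q)" "2 * q"]]) (use assms in auto)
      then show ?thesis by (rule summable_sums[OF summable_norm_cancel])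
    qed
    have "(\<lambda>s. 1 / 2 * ?t u s + 1 / 2 * ?t v s) sums (1 / 2 * ?U + 1 / 2 * ?V)"
      using uv by (intro sums_add sums_mult sum)
    \<comment> \<open>The index s = 0 may be dropped, since the trapezoidal rule is exact for
      constants.\<close>
    then have "(\<lambda>s. 1 / 2 * ?t u (Suc s) + 1 / 2 * ?t v (Suc s)) sums (1 / 2 * ?U + 1 / 2 * ?V)"
      by (subst sums_Suc_iff) (simp add: zeta_err_0)
    then have "(\<lambda>s. eisenstein_series_term q y (Suc s)) sums (1 / 2 * ?U + 1 / 2 * ?V)"
      unfolding eisenstein_series_term_eq[OF assms(1) zero_less_Suc] u_def v_def .
    then show ?thesis using sums_unique by (fastforce simp only: distrib_left)
  qed
  ultimately show "eisenstein_imag y q =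
      2 * of_real ?\<kappa> powr q *
        (riemann_zeta (2 * q - 1) * gauss_2F1 1 q (3 / 2) (of_real (1 / (1 + y\<^sup>2))) +
         riemann_zeta (2 * q - 1) * gauss_2F1 1 q (3 / 2) (of_real (y\<^sup>2 / (1 + y\<^sup>2)))) +
      4 * of_real ?\<kappa> powr q * (\<Sum>s. eisenstein_series_term q y (Suc s))"
    unfolding half_eisenstein_def u_def[symmetric] v_def[symmetric]
    by (simp only:) (simp add: algebra_simps)
next
  fix a b :: real assume ab: "0 < a \<and> a \<le> b"
  \<comment> \<open>On [a, b] the base 1/(1 + y^2) is largest at a and y^2/(1 + y^2) at b, so
    \<open>r < 1\<close> bounds both uniformly in y.\<close>
  define r where "r = max (1 / (1 + a\<^sup>2)) (b\<^sup>2 / (1 + b\<^sup>2))"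
  have pos: "0 < 1 + x\<^sup>2" for x :: real by (simp add: add_pos_nonneg)
  have r: "0 \<le> r" "r < 1" using ab by (auto simp: r_def less_max_iff_disj le_max_iff_disj pos)
  define C where "C = 2 * (\<Sum>n. real (Suc n) powr (- Re (2 * q) - 1))"
  define M where "M s = C * pochhammer_majorant (norm q + 1) r s" for s
  have "summable M"
    unfolding M_def using r by (intro summable_mult summable_pochhammer_majorant) (auto intro: add_nonneg_pos)
  then have sM: "summable (\<lambda>s. M (Suc s))" by (subst summable_Suc_iff)
  have "norm (eisenstein_series_term q y (Suc s)) \<le> M (Suc s)" if y: "y \<in> {a..b}" for y s
  proof -
    have x: "norm (pochhammer q (Suc s) / fact (Suc s) * zeta_err (Suc s) (2 * q) * of_real x ^ Suc s) \<le> M (Suc s)"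
      if "0 \<le> x" "x \<le> r" for x
      unfolding M_def C_def using assms that by (intro norm_pochhammer_term_le zeta_err_bound) auto
    have "1 / (1 + y\<^sup>2) \<le> 1 / (1 + a\<^sup>2)"
      using y ab pos by (intro divide_left_mono mult_pos_pos) (auto intro!: power_mono)
    then have u: "0 \<le> 1 / (1 + y\<^sup>2)" "1 / (1 + y\<^sup>2) \<le> r" by (auto simp: r_def)
    \<comment> \<open>Reduces the monotonicity of the second base to that of the first.\<close>
    have frac: "x\<^sup>2 / (1 + x\<^sup>2) = 1 - 1 / (1 + x\<^sup>2)" for x :: real
      using pos[of x] by (simp add: field_simps)
    have "1 / (1 + b\<^sup>2) \<le> 1 / (1 + y\<^sup>2)"
      using y ab pos by (intro divide_left_mono mult_pos_pos) (auto intro!: power_mono)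
    then have v: "0 \<le> y\<^sup>2 / (1 + y\<^sup>2)" "y\<^sup>2 / (1 + y\<^sup>2) \<le> r" 
      by (simp, simp add: r_def frac le_max_iff_disj)
    have "norm (1 / 2 * A + 1 / 2 * B) \<le> m" if "norm A \<le> m" "norm B \<le> m" for A B :: complex and m
      using norm_triangle_ineq[of "1 / 2 * A" "1 / 2 * B"] that by (simp add: norm_mult)
    from this[OF x[OF u] x[OF v]] show ?thesis
      unfolding eisenstein_series_term_eq[OF assms(1) zero_less_Suc] .
  qed
  from Weierstrass_m_test[OF this sM]
  have "uniform_limit {a..b} (\<lambda>N y. \<Sum>s<N. eisenstein_series_term q y (Suc s))
          (\<lambda>y. \<Sum>s. eisenstein_series_term q y (Suc s)) sequentially" .
  then show "uniform_limit {a..b} (\<lambda>N y. \<Sum>s = 1..N. eisenstein_series_term q y s)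
          (\<lambda>y. \<Sum>s. eisenstein_series_term q y (Suc s)) sequentially"
    by (simp add: sum.atLeast1_atMost_eq)
qed

end
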